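(* Assume that $(X,d)$ has the Heine–Borel property. Let $m\in[0,+\infty)$ and let $E_k\in\mathcal B(X)$, $k\in\mathbb N$, satisfy $\mu(E_k)=m$ for all $k$ and $\sup_kP(E_k)<+\infty$. Suppose that (i) $G$ acts on $X$ properly discontinuously; (ii) there is a precompact $B\in\mathcal B(X)$ with $\mu(\partial B)=0$ such that $GB=X$ and $\mu(gB\cap B)=0$ for all $g\in G$ except $g=1$; (iii) there are an $\varepsilon>0$ and a precompact open $V\subset X$ with $B\subset V$ such that the local isoperimetric inequality \[ P(E,V)\ge f(\mu(E\cap V)) \] holds for all Borel $E\subset X$ with $\mu(E\cap V)\le\varepsilon$, with some nondecreasing function $f\colon\mathbb R^+\to\mathbb R^+$ such that $f(0)=0$ and $f'(0)=+\infty$. Then there are a subsequence of $E_k$ (not relabeled), an at most countable index set $I$, Borel sets $E^i\subset X$ and elements $g_k^i\in G$, $i\in I$, such that \[ \lim_k(g_k^{i'})^{-1}g_k^i=\infty\quad\text{for all } i\neq i', \] \[ (g_k^i)^{-1}E_k\xrightarrow{L^1_{\mathrm{loc}}(\mu)}E^i\quad\text{as } k\to+\infty,\ \text{for every } i\in I, \] \[ \sum_{i\in I}\mu(E^i)=m. \]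
   Context: $(X,d,\mu)$ is a metric measure space with distance $d$ and nonnegative $\sigma$-finite Radon measure $\mu$ with $\mu(X)\neq0$. $G$ is a discrete, countable, topological group acting on $X$ by homeomorphisms preserving the measure $\mu$; the action is properly discontinuous if $\{g\in G: gK\cap K\neq\emptyset\}$ is finite for every compact $K\subset X$. For $B\subset X$, $GB:=\bigcup_{g\in G}gB$. $\mathcal B(X)$ is the Borel $\sigma$-algebra of $X$ and $\mathcal A(X)$ the class of open subsets of $X$. $(X,d)$ has the Heine–Borel property if every closed ball is compact. $\mathbb R^+=[0,+\infty)$, and $f'(0)=+\infty$ means $f(t)/t\to+\infty$ as $t\to0^+$. Convergence of sets $B_k\to B$ in $L^1_{\mathrm{loc}}(\mu)$ means that $\mathbf 1_{B_k}\to\mathbf 1_B$ in $L^1(\mu)$ on every compact subset of $X$. For a sequence $g_k\in G$, $\lim_k g_k=\infty$ means that for every finite $A\subset G$ the set $\{k: g_k\in A\}$ is finite. $P\colon\mathcal B(X)\times\mathcal A(X)\to\mathbb R^+\cup\{\infty\}$ is a "relative perimeter" functional, with $P(E):=P(E,X)$, satisfying: (semicontinuity) $P(D,U)\le\liminf_kP(D_k,U)$ whenever $D_k\to D$ in $L^1_{\mathrm{loc}}(\mu)$; (Beppo Levi) if $U_k\nearrow X$ then $P(D,U_k)\nearrow P(D)$; (monotonicity) $P(B,U)\le P(B,V)$ if $U\subset V$; (superadditivity) $P(B,U)\ge\sum_{k=1}^MP(B,U_k)$ whenever $U=\bigsqcup_{k=1}^MU_k$; ($G$-invariance) $P(gB,gU)=P(B,U)$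 for every $g\in G$; (compactness) if $E_k\subset X$ satisfy $\sup_kP(E_k,U)<+\infty$ for some precompact open set $U$, then there is $E\subset X$ such that, up to a subsequence, $E_k\cap U\to E$ in $L^1(\mu)$ (i.e. the characteristic functions converge). *)

theory Defs
  imports "HOL-Analysis.Analysis" "HOL-Algebra.Group_Action"
begin

definition radon_measure :: "'a::topological_space measure \<Rightarrow> bool" where
  "radon_measure \<mu> \<longleftrightarrow>
     sets \<mu> = sets borel \<and>
     (\<forall>K. compact K \<longrightarrow> emeasure \<mu> K < \<infinity>) \<and>
     (\<forall>A\<in>sets borel. emeasure \<mu> A = (SUP K\<in>{K. compact K \<and> K \<subseteq> A}. emeasure \<mu> K))"

definition precompact :: "'a::topological_space set \<Rightarrow> bool" where
  "precompact A \<longleftrightarrow> compact (closure A)"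

definition heine_borel_property :: "'a::metric_space itself \<Rightarrow> bool" where
  "heine_borel_property _ \<longleftrightarrow> (\<forall>(x::'a) r. compact (cball x r))"

text \<open>
  Sets converge when their indicator functions do. Taking \<open>S = UNIV\<close> gives convergence in \<open>L\<^sup>1\<close>.
\<close>

definition L1_set_conv_on :: "'a measure \<Rightarrow> 'a set \<Rightarrow> (nat \<Rightarrow> 'a set) \<Rightarrow> 'a set \<Rightarrow> bool" where
  "L1_set_conv_on \<mu> S B B' \<longleftrightarrow>
     (\<lambda>k. \<integral>\<^sup>+x\<in>S. ennreal \<bar>indicat_real (B k) x - indicat_real B' x\<bar> \<partial>\<mu>) \<longlonglongrightarrow> 0"

definition L1loc_set_conv ::
    "'a::topological_space measure \<Rightarrow> (nat \<Rightarrow> 'a set) \<Rightarrow> 'a set \<Rightarrow> bool" where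
  "L1loc_set_conv \<mu> B B' \<longleftrightarrow> (\<forall>K. compact K \<longrightarrow> L1_set_conv_on \<mu> K B B')"

text \<open>
  The group is discrete, so it carries no topological data and joint continuity of the action
  amounts to every \<open>\<phi> g\<close> being a homeomorphism.
\<close>

locale measure_preserving_action = group_action G "UNIV :: 'a::metric_space set" \<phi>
  for G :: "('g, 'm) monoid_scheme" (structure) and \<phi> :: "'g \<Rightarrow> 'a::metric_space \<Rightarrow> 'a" +
  fixes \<mu> :: "'a::metric_space measure"
  assumes countable_group: "countable (carrier G)"
    and homeo: "\<And>g. g \<in> carrier G \<Longrightarrow> homeomorphism UNIV UNIV (\<phi> g) (\<phi> (inv\<^bsub>G\<^esub> g))"
    and preserves_measure:
      "\<And>g A. g \<in> carrier G \<Longrightarrow> A \<in> sets borel \<Longrightarrow> emeasure \<mu> (\<phi> g ` A) = emeasure \<mu> A"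

definition properly_discontinuous ::
    "('g, 'm) monoid_scheme \<Rightarrow> ('g \<Rightarrow> 'a::topological_space \<Rightarrow> 'a) \<Rightarrow> bool" where
  "properly_discontinuous G \<phi> \<longleftrightarrow>
     (\<forall>K. compact K \<longrightarrow> finite {g \<in> carrier G. \<phi> g ` K \<inter> K \<noteq> {}})"

definition tends_to_infinity :: "('g, 'm) monoid_scheme \<Rightarrow> (nat \<Rightarrow> 'g) \<Rightarrow> bool" where
  "tends_to_infinity G g \<longleftrightarrow> (\<forall>A. A \<subseteq> carrier G \<longrightarrow> finite A \<longrightarrow> finite {k. g k \<in> A})"

text \<open>
  \<open>P\<close> is only meaningful on pairs of a Borel set and an open set, so every axiom is
  restricted to such arguments; the total perimeter of \<open>E\<close> is \<open>P E UNIV\<close>.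
\<close>

locale relative_perimeter =
  fixes G :: "('g, 'm) monoid_scheme" (structure)
    and \<phi> :: "'g \<Rightarrow> 'a::metric_space \<Rightarrow> 'a"
    and \<mu> :: "'a measure"
    and P :: "'a set \<Rightarrow> 'a set \<Rightarrow> ennreal"
  assumes semicontinuity:
      "\<And>D D' U. \<lbrakk>\<And>k. D k \<in> sets borel; D' \<in> sets borel; open U; L1loc_set_conv \<mu> D D'\<rbrakk>
         \<Longrightarrow> P D' U \<le> liminf (\<lambda>k. P (D k) U)"
    and beppo_levi:
      "\<And>D U. \<lbrakk>D \<in> sets borel; \<And>k. open (U k); incseq U; (\<Union>k. U k) = UNIV\<rbrakk>
         \<Longrightarrow> incseq (\<lambda>k. P D (U k)) \<and> (\<lambda>k. P D (U k)) \<longlonglongrightarrow> P D UNIV"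
    and monotonicity:
      "\<And>B U V. \<lbrakk>B \<in> sets borel; open U; open V; U \<subseteq> V\<rbrakk> \<Longrightarrow> P B U \<le> P B V"
    and superadditivity:
      "\<And>B U (M::nat). \<lbrakk>B \<in> sets borel; \<And>k. k < M \<Longrightarrow> open (U k); disjoint_family_on U {..<M}\<rbrakk>
         \<Longrightarrow> (\<Sum>k<M. P B (U k)) \<le> P B (\<Union>k<M. U k)"
    and invariance:
      "\<And>g B U. \<lbrakk>g \<in> carrier G; B \<in> sets borel; open U\<rbrakk> \<Longrightarrow> P (\<phi> g ` B) (\<phi> g ` U) = P B U"
    and compactness:
      "\<And>E U. \<lbrakk>\<And>k. E k \<in> sets borel; open U; precompact U; (SUP k. P (E k) U) < \<infinity>\<rbrakk>
         \<Longrightarrow> \<exists>E'\<in>sets borel. \<exists>r. strict_mono (r :: nat \<Rightarrow> nat) \<and>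
               L1_set_conv_on \<mu> UNIV (\<lambda>k. E (r k) \<inter> U) E'"

end

theory Submission
  imports Defs "HOL-Library.Diagonal_Subsequence"
begin

text \<open>
  The sets \<open>E k\<close> have fixed mass and bounded perimeter. Mass can be lost in a limit only by spreading
  out thinly or by moving to infinity. The isoperimetric inequality excludes the first: on a cell
  \<open>\<phi> h ` V\<close> in which \<open>E k\<close> has small mass, the perimeter in that cell is at least a large constant
  times this mass, because \<open>f\<close> has infinite slope at \<open>0\<close>. By proper discontinuity the cells overlap
  only boundedly often, so the perimeters in all cells add up to at most a constant times the total
  perimeter. Hence the cells of small mass carry together an arbitrarily small part of \<open>m\<close>, uniformly
  in \<open>k\<close> (\<open>emeasure_small_cells_le\<close>). The same bound on overlaps limits the number of the remaining,
  massive cells, again uniformly in \<open>k\<close> (\<open>ex_card_bound_large_cells\<close>).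
  
  For the mass threshold \<open>1 / (n + 1)\<close>, reserve as many indices as there can be massive cells, and let
  \<open>g i k\<close>, over these indices \<open>i\<close>, run through the massive cells of \<open>E k\<close>. Then finitely many indices
  capture all but an arbitrarily small part of the mass for all \<open>k\<close> at once (\<open>ex_tight_translates\<close>).
  Indices left over are filled with arbitrary group elements; the equivalence below
  merges indices that follow the same cell.
  
  A diagonal argument gives a subsequence along which every translate \<open>\<phi> (inv (g i k)) ` E k\<close>
  converges locally, and every relative displacement \<open>inv (g i k) \<otimes> g j k\<close> either settles at
  a constant or tends to infinity (\<open>ex_convergent_subsequence\<close>). Settling is an equivalence relation
  on the indices. Indices in one class follow the same lump of mass up to a fixed group element,
  so one index from each class is kept.
  
  The limits over the kept indices then have total mass \<open>m\<close>. It is at most \<open>m\<close>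
  (\<open>sum_emeasure_limits_le\<close>), since for any compact \<open>K\<close> finitely many of the sets \<open>\<phi> (g i k) ` K\<close> are
  disjoint for large \<open>k\<close>. It is at least \<open>m\<close> (\<open>le_sum_emeasure_limits\<close>), since the cells of all but
  a small part of the mass lie in translates of one compact set by the kept \<open>g i k\<close>, and no mass
  of a compact set escapes in an \<open>L\<^sup>1\<close> limit.
\<close>

section \<open>Finite combinatorics and countable limits\<close>

lemma ex_linear_bound_of_superlinear:
  fixes f :: "real \<Rightarrow> real"
  assumes lim: "filterlim (\<lambda>t. f t / t) at_top (at_right 0)" and f0: "0 \<le> f 0" and "0 < \<epsilon>"
  shows "\<exists>\<delta>>0. \<delta> \<le> \<epsilon> \<and> (\<forall>t. 0 \<le> t \<and> t \<le> \<delta> \<longrightarrow> C * t \<le> f t)"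
proof -
  have "\<forall>\<^sub>F t in at_right 0. C \<le> f t / t"
    using lim by (simp add: filterlim_at_top)
  then obtain b where b: "b > 0" "\<And>t. 0 < t \<Longrightarrow> t < b \<Longrightarrow> C \<le> f t / t"
    unfolding eventually_at_right_field by auto
  have "C * t \<le> f t" if "0 \<le> t" "t \<le> min \<epsilon> (b / 2)" for t
  proof (cases "t = 0")
    case False
    then show ?thesis
      using b(2)[of t] that b(1) by (simp add: pos_le_divide_eq)
  qed (use f0 in simp)
  then show ?thesis
    using b(1) \<open>0 < \<epsilon>\<close> by (intro exI[of _ "min \<epsilon> (b / 2)"]) auto
qed

lemma ex_enumeration_of_card_le:
  fixes A T :: "'b set"
  assumes "finite T" "card T \<le> M" "T \<subseteq> A" "A \<noteq> {}"
  shows "\<exists>e :: nat \<Rightarrow> 'b. range e \<subseteq> A \<and> T \<subseteq> e ` {..<M}"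
proof -
  obtain b where b: "bij_betw b {0..<card T} T"
    using ex_bij_betw_nat_finite[OF assms(1)] by blast
  obtain a where a: "a \<in> A"
    using assms(4) by blast
  define e where "e j = (if j < card T then b j else a)" for j
  have "e ` {0..<card T} = T"
    using b by (auto simp: e_def bij_betw_def)
  then have "T \<subseteq> e ` {..<M}"
    using assms(2) by (metis atLeast0LessThan image_mono lessThan_subset_iff)
  moreover have "range e \<subseteq> A"
    using b a assms(3) by (auto simp: e_def bij_betw_def)
  ultimately show ?thesis by blast
qed

lemma diagonal_subsequence:
  fixes Q :: "'i::countable \<Rightarrow> (nat \<Rightarrow> nat) \<Rightarrow> bool"
  assumes refinement: "\<And>i (s::nat \<Rightarrow> nat). strict_mono s \<Longrightarrow> \<exists>r::nat \<Rightarrow> nat. strict_mono r \<and> Q i (s \<circ> r)"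
    and subseq: "\<And>i s (r::nat \<Rightarrow> nat). strict_mono r \<Longrightarrow> Q i s \<Longrightarrow> Q i (s \<circ> r)"
    and tail: "\<And>i s (n::nat). Q i (s \<circ> (+) n) \<Longrightarrow> Q i s"
  shows "\<exists>s. strict_mono s \<and> (\<forall>i. Q i s)"
proof -
  interpret subseqs "\<lambda>n. Q (from_nat n)"
    by unfold_locales (rule refinement)
  have "Q (from_nat n) diagseq" for n
    using tail[OF diagseq_holds[OF subseq]] .
  then have "Q i diagseq" for i
    by (metis from_nat_to_nat)
  then show ?thesis
    using subseq_diagseq by blast
qed

text \<open>
  Greedy colouring: a new vertex has at most \<open>N\<close> coloured neighbours, so one of the \<open>N + 1\<close> colours
  \<open>0, \<dots>, N\<close> is free for it.
\<close>

lemma ex_proper_colouring: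
  assumes "finite H" and "symp R"
    and "\<And>x. x \<in> H \<Longrightarrow> card {y \<in> H. y \<noteq> x \<and> R x y} \<le> N"
  shows "\<exists>col. (\<forall>x\<in>H. col x \<le> N) \<and> (\<forall>x\<in>H. \<forall>y\<in>H. x \<noteq> y \<longrightarrow> R x y \<longrightarrow> col x \<noteq> (col y :: nat))"
  using assms(1,3)
proof (induction H)
  case empty
  then show ?case by simp
next
  case (insert x H)
  have deg: "card {y \<in> H. y \<noteq> z \<and> R z y} \<le> N" if "z \<in> H" for z
  proof -
    have "card {y \<in> H. y \<noteq> z \<and> R z y} \<le> card {y \<in> insert x H. y \<noteq> z \<and> R z y}"
      using insert.hyps by (intro card_mono) auto
    also have "\<dots> \<le> N"
      using that by (intro insert.prems) simp
    finally show ?thesis .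
  qed
  have "\<exists>col. (\<forall>z\<in>H. col z \<le> N) \<and>
      (\<forall>z\<in>H. \<forall>y\<in>H. z \<noteq> y \<longrightarrow> R z y \<longrightarrow> col z \<noteq> (col y :: nat))"
    by (rule insert.IH) (rule deg)
  then obtain col :: "_ \<Rightarrow> nat" where col: "\<forall>z\<in>H. col z \<le> N"
      "\<forall>z\<in>H. \<forall>y\<in>H. z \<noteq> y \<longrightarrow> R z y \<longrightarrow> col z \<noteq> col y"
    by (elim exE conjE) (rule that)
  define nb where "nb = {y \<in> insert x H. y \<noteq> x \<and> R x y}"
  have fin: "finite nb"
    using insert.hyps(1) by (simp add: nb_def)
  have le: "card nb \<le> N"
    unfolding nb_def by (rule insert.prems) simp
  have "card (col ` nb) < card {..N}"
    using card_image_le[OF fin, of col] le by (simp add: less_Suc_eq_le)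
  then have "\<not> {..N} \<subseteq> col ` nb"
    using card_mono[of "col ` nb" "{..N}"] fin by auto
  then obtain c where c: "c \<le> N" "c \<notin> col ` nb"
    by auto
  have x: "col y \<noteq> c" if "y \<in> H" "R x y \<or> R y x" for y
  proof -
    have "y \<in> nb"
      using that insert.hyps(2) sympD[OF \<open>symp R\<close>, of y x] by (auto simp: nb_def)
    then show ?thesis
      using c(2) by blast
  qed
  have "\<forall>z\<in>insert x H. \<forall>y\<in>insert x H. z \<noteq> y \<longrightarrow> R z y \<longrightarrow>
      (col(x := c)) z \<noteq> (col(x := c)) y"
  proof (intro ballI impI)
    fix z y assume zy: "z \<in> insert x H" "y \<in> insert x H" "z \<noteq> y" "R z y"
    consider "z = x" | "y = x" | "z \<noteq> x" "y \<noteq> x" by blast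
    then show "(col(x := c)) z \<noteq> (col(x := c)) y"
    proof cases
      case 1
      then show ?thesis
        using zy x[of y] by auto
    next
      case 2
      then show ?thesis
        using zy x[of z] by auto
    next
      case 3
      then show ?thesis
        using zy col(2) by auto
    qed
  qed
  moreover have "\<forall>z\<in>insert x H. (col(x := c)) z \<le> N"
    using c(1) col(1) by simp
  ultimately show ?case
    by (intro exI[of _ "col(x := c)"] conjI)
qed

text \<open>
  Each colour class of a proper colouring is independent, so the hypothesis applies to it, and \<open>N + 1\<close>
  classes cover \<open>H\<close>. Superadditivity of the perimeter speaks of disjoint open sets only; this lemma
  extends its consequences to families with bounded overlap.
\<close>

lemma sum_le_of_independent_sums_le:
  fixes w :: "'b \<Rightarrow> ennreal"
  assumes H: "finite H" and R: "symp R"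
    and degree: "\<And>x. x \<in> H \<Longrightarrow> card {y \<in> H. y \<noteq> x \<and> R x y} \<le> N"
    and indep: "\<And>H'. H' \<subseteq> H \<Longrightarrow> pairwise (\<lambda>x y. \<not> R x y) H' \<Longrightarrow> sum w H' \<le> c"
  shows "sum w H \<le> of_nat (Suc N) * c"
proof -
  have "\<exists>col. (\<forall>x\<in>H. col x \<le> N) \<and>
      (\<forall>x\<in>H. \<forall>y\<in>H. x \<noteq> y \<longrightarrow> R x y \<longrightarrow> col x \<noteq> (col y :: nat))"
    by (rule ex_proper_colouring[OF H R]) (rule degree)
  then obtain col :: "'b \<Rightarrow> nat" where col: "\<forall>x\<in>H. col x \<le> N"
      "\<forall>x\<in>H. \<forall>y\<in>H. x \<noteq> y \<longrightarrow> R x y \<longrightarrow> col x \<noteq> col y"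
    by (elim exE conjE) (rule that)
  have "sum w H = (\<Sum>i\<in>{..N}. sum w {x\<in>H. col x = i})"
    by (rule sum.group[OF H, symmetric]) (use col(1) in auto)
  also have "\<dots> \<le> of_nat (card {..N}) * c"
  proof (rule sum_bounded_above)
    fix i assume "i \<in> {..N}"
    show "sum w {x\<in>H. col x = i} \<le> c"
    proof (rule indep)
      show "pairwise (\<lambda>x y. \<not> R x y) {x\<in>H. col x = i}"
        unfolding pairwise_def
      proof (intro ballI impI notI)
        fix x y assume xy: "x \<in> {x\<in>H. col x = i}" "y \<in> {x\<in>H. col x = i}" "x \<noteq> y" "R x y"
        then have "x \<in> H" "y \<in> H" "col x = col y"
          by simp_all
        then show False
          using col(2)[THEN bspec[of _ _ x], THEN bspec[of _ _ y]] xy(3,4) by simp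
      qed
    qed auto
  qed
  finally show ?thesis by simp
qed

lemma emeasure_UN_le_of_finite_subunions:
  assumes I: "countable I" and A: "\<And>i. i \<in> I \<Longrightarrow> A i \<in> sets M"
    and fin: "\<And>H. finite H \<Longrightarrow> H \<subseteq> I \<Longrightarrow> emeasure M (\<Union>i\<in>H. A i) \<le> c"
  shows "emeasure M (\<Union>i\<in>I. A i) \<le> c"
proof (cases "I = {}")
  case False
  define H where "H n = from_nat_into I ` {..<n::nat}" for n
  have H: "finite (H n)" "H n \<subseteq> I" for n
    using from_nat_into[OF False] by (auto simp: H_def)
  have "(\<Union>n. \<Union>i\<in>H n. A i) = (\<Union>i\<in>range (from_nat_into I). A i)"
    by (auto simp: H_def)
  then have eq: "(\<Union>n. \<Union>i\<in>H n. A i) = (\<Union>i\<in>I. A i)"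
    using I False by (simp add: range_from_nat_into)
  have "(\<lambda>n. emeasure M (\<Union>i\<in>H n. A i)) \<longlonglongrightarrow> emeasure M (\<Union>n. \<Union>i\<in>H n. A i)"
  proof (rule Lim_emeasure_incseq)
    show "range (\<lambda>n. \<Union>i\<in>H n. A i) \<subseteq> sets M"
      using H A by (blast intro: sets.finite_UN)
    show "incseq (\<lambda>n. \<Union>i\<in>H n. A i)"
      unfolding incseq_def H_def by (intro allI impI UN_mono image_mono) auto
  qed
  then show ?thesis
    unfolding eq by (rule LIMSEQ_le_const2) (use fin H in blast)
qed (use fin[of "{}"] in simp)

section \<open>Convergence of sets\<close>

lemma L1_set_conv_on_iff_emeasure:
  assumes "S \<in> sets M" "\<And>k. B k \<in> sets M" "B' \<in> sets M"
  shows "L1_set_conv_on M S B B' \<longleftrightarrow> (\<lambda>k. emeasure M (S \<inter> sym_diff (B k) B')) \<longlonglongrightarrow> 0"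
proof -
  have "(\<integral>\<^sup>+x\<in>S. ennreal \<bar>indicat_real (B k) x - indicat_real B' x\<bar> \<partial>M)
      = emeasure M (S \<inter> sym_diff (B k) B')" for k
  proof -
    have "(\<integral>\<^sup>+x\<in>S. ennreal \<bar>indicat_real (B k) x - indicat_real B' x\<bar> \<partial>M)
        = (\<integral>\<^sup>+x. indicator (S \<inter> sym_diff (B k) B') x \<partial>M)"
      by (intro nn_integral_cong) (auto simp: indicator_def)
    also have "\<dots> = emeasure M (S \<inter> sym_diff (B k) B')"
      by (rule nn_integral_indicator) (use assms in auto)
    finally show ?thesis .
  qed
  then show ?thesis
    by (simp add: L1_set_conv_on_def)
qed

lemma L1loc_set_conv_emeasure:
  fixes \<mu> :: "'a::metric_space measure"
  assumes "sets \<mu> = sets borel" "L1loc_set_conv \<mu> B B'" "compact K"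
    and "\<And>k. B k \<in> sets borel" "B' \<in> sets borel"
  shows "(\<lambda>k. emeasure \<mu> (K \<inter> sym_diff (B k) B')) \<longlonglongrightarrow> 0"
proof -
  have "K \<in> sets \<mu>"
    using assms(1,3) by (simp add: borel_closed compact_imp_closed)
  then have "L1_set_conv_on \<mu> K B B' \<longleftrightarrow> (\<lambda>k. emeasure \<mu> (K \<inter> sym_diff (B k) B')) \<longlonglongrightarrow> 0"
    using assms by (intro L1_set_conv_on_iff_emeasure) simp_all
  then show ?thesis
    using assms(2,3) by (simp add: L1loc_set_conv_def)
qed

lemma L1_set_conv_on_subseq:
  "L1_set_conv_on M S B B' \<Longrightarrow> strict_mono r \<Longrightarrow> L1_set_conv_on M S (\<lambda>k. B (r k)) B'"
  unfolding L1_set_conv_on_def by (drule (1) LIMSEQ_subseq_LIMSEQ) (simp add: o_def)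

lemma L1_set_conv_on_tail:
  "L1_set_conv_on M S (\<lambda>k. B (n + k)) B' \<Longrightarrow> L1_set_conv_on M S B B'"
  unfolding L1_set_conv_on_def by (rule LIMSEQ_offset[of _ n]) (simp add: add.commute)

lemma emeasure_Int_le_add_sym_diff:
  assumes "S \<in> sets M" "A \<in> sets M" "B \<in> sets M"
  shows "emeasure M (A \<inter> S) \<le> emeasure M (B \<inter> S) + emeasure M (S \<inter> sym_diff A B)"
proof -
  have "emeasure M (A \<inter> S) \<le> emeasure M ((B \<inter> S) \<union> (S \<inter> sym_diff A B))"
    using assms by (intro emeasure_mono) auto
  also have "\<dots> \<le> emeasure M (B \<inter> S) + emeasure M (S \<inter> sym_diff A B)"
    using assms by (intro emeasure_subadditive) auto
  finally show ?thesis .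
qed

text \<open>
  The limits on different balls are given independently of each other. Using the limit on the \<open>n\<close>-th
  ball only on the shell between balls \<open>n - 1\<close> and \<open>n\<close> glues them without comparing them.
\<close>

lemma L1loc_set_conv_of_balls:
  fixes \<mu> :: "'a::metric_space measure" and x0 :: 'a
  assumes sets: "sets \<mu> = sets borel" and F: "\<And>k. F k \<in> sets borel"
    and balls: "\<And>N::nat. \<exists>D\<in>sets borel. L1_set_conv_on \<mu> UNIV (\<lambda>k. F k \<inter> ball x0 (real N)) D"
  shows "\<exists>D\<in>sets borel. L1loc_set_conv \<mu> F D"
proof -
  define U where "U N = ball x0 (real N)" for N
  obtain D where D: "\<And>N. D N \<in> sets borel"
      "\<And>N. L1_set_conv_on \<mu> UNIV (\<lambda>k. F k \<inter> U N) (D N)"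
    using balls unfolding U_def by metis
  have U: "U N \<in> sets borel" for N
    by (simp add: U_def)
  have shell: "disjointed U n \<in> sets borel" for n
    using U by (auto simp: disjointed_def)
  define E where "E = (\<Union>n. D n \<inter> disjointed U n)"
  have E: "E \<in> sets borel"
    unfolding E_def using D(1) shell by auto
  have "L1_set_conv_on \<mu> K F E" if K: "compact K" for K
  proof -
    have Kb: "K \<in> sets borel"
      using K by (simp add: borel_closed compact_imp_closed)
    obtain r where "\<forall>y\<in>K. dist x0 y \<le> r"
      using compact_imp_bounded[OF K] by (meson bounded_any_center)
    moreover obtain N :: nat where "r < N"
      using reals_Archimedean2 by blast
    ultimately have KN: "K \<subseteq> U N"
      by (fastforce simp: U_def subset_iff)
    have incl: "K \<inter> sym_diff (F k) E \<subseteq> (\<Union>n\<in>{..N}. sym_diff (F k \<inter> U n) (D n))" for k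
    proof
      fix x assume x: "x \<in> K \<inter> sym_diff (F k) E"
      define n where "n = (LEAST n. x \<in> U n)"
      have "x \<in> U N"
        using x KN by auto
      then have n: "x \<in> U n" "n \<le> N"
        unfolding n_def by (rule LeastI, rule Least_le)
      have xn: "x \<in> disjointed U n"
        using n(1) not_less_Least[of _ "\<lambda>n. x \<in> U n", folded n_def]
        unfolding disjointed_def by auto
      have "j = n" if "x \<in> disjointed U j" for j
        using xn that disjoint_family_disjointed[of U] unfolding disjoint_family_on_def by blast
      then have "x \<in> E \<longleftrightarrow> x \<in> D n"
        using xn unfolding E_def by blast
      then show "x \<in> (\<Union>n\<in>{..N}. sym_diff (F k \<inter> U n) (D n))"
        using x n by auto
    qed
    have "(\<lambda>k. \<Sum>n\<in>{..N}. emeasure \<mu> (sym_diff (F k \<inter> U n) (D n))) \<longlonglongrightarrow> (\<Sum>n\<in>{..N}. 0)"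
    proof (rule tendsto_sum)
      fix n
      show "(\<lambda>k. emeasure \<mu> (sym_diff (F k \<inter> U n) (D n))) \<longlonglongrightarrow> 0"
        using D(2)[of n] L1_set_conv_on_iff_emeasure[of UNIV \<mu> "\<lambda>k. F k \<inter> U n" "D n"] F U D(1)
        by (simp add: sets)
    qed
    then have lim: "(\<lambda>k. \<Sum>n\<in>{..N}. emeasure \<mu> (sym_diff (F k \<inter> U n) (D n))) \<longlonglongrightarrow> 0"
      by simp
    have le: "emeasure \<mu> (K \<inter> sym_diff (F k) E)
        \<le> (\<Sum>n\<in>{..N}. emeasure \<mu> (sym_diff (F k \<inter> U n) (D n)))" for k
    proof -
      have "emeasure \<mu> (K \<inter> sym_diff (F k) E)
          \<le> emeasure \<mu> (\<Union>n\<in>{..N}. sym_diff (F k \<inter> U n) (D n))"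
        using incl F U D(1) by (intro emeasure_mono) (auto simp: sets)
      also have "\<dots> \<le> (\<Sum>n\<in>{..N}. emeasure \<mu> (sym_diff (F k \<inter> U n) (D n)))"
        using F U D(1) by (intro emeasure_subadditive_finite) (auto simp: sets)
      finally show ?thesis .
    qed
    have "(\<lambda>k. emeasure \<mu> (K \<inter> sym_diff (F k) E)) \<longlonglongrightarrow> 0"
      by (rule tendsto_sandwich[OF _ _ tendsto_const lim]) (use le in auto)
    then show ?thesis
      using L1_set_conv_on_iff_emeasure[of K \<mu> F E] Kb F E by (simp add: sets)
  qed
  then show ?thesis
    using E by (auto simp: L1loc_set_conv_def)
qed

section \<open>Sequences that settle or tend to infinity\<close>

text \<open>
  If the sequence visits some finite set infinitely often, then it visits one of its elements
  infinitely often.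
\<close>

lemma ex_constant_or_tends_to_infinity_subseq:
  assumes "\<And>k. h k \<in> carrier G"
  shows "\<exists>r. strict_mono (r :: nat \<Rightarrow> nat) \<and>
    ((\<exists>a. \<forall>\<^sub>F k in sequentially. h (r k) = a) \<or> tends_to_infinity G (h \<circ> r))"
proof (cases "tends_to_infinity G h")
  case True
  then show ?thesis
    by (intro exI[of _ id]) (auto simp: strict_mono_def)
next
  case False
  then obtain A where A: "finite A" "infinite {k. h k \<in> A}"
    by (auto simp: tends_to_infinity_def)
  have "{k. h k \<in> A} = (\<Union>a\<in>A. {k. h k = a})"
    by auto
  with A obtain a where "infinite {k. h k = a}"
    by auto
  then obtain r :: "nat \<Rightarrow> nat" where "strict_mono r" "\<And>k. r k \<in> {k. h k = a}"
    using infinite_enumerate by blast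
  then show ?thesis
    by (intro exI[of _ r]) auto
qed

lemma tends_to_infinity_subseq:
  assumes "tends_to_infinity G h" and r: "strict_mono (r :: nat \<Rightarrow> nat)"
  shows "tends_to_infinity G (h \<circ> r)"
  unfolding tends_to_infinity_def
proof (intro allI impI)
  fix A assume "A \<subseteq> carrier G" "finite A"
  then have "finite {k. h k \<in> A}"
    using assms(1) by (simp add: tends_to_infinity_def)
  then have "finite (r -` {k. h k \<in> A})"
    by (rule finite_vimageI) (rule strict_mono_imp_inj_on[OF r])
  then show "finite {k. (h \<circ> r) k \<in> A}"
    by (simp add: vimage_def)
qed

lemma tends_to_infinity_tail:
  assumes "tends_to_infinity G (h \<circ> (+) n)"
  shows "tends_to_infinity G h"
  unfolding tends_to_infinity_def
proof (intro allI impI)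
  fix A assume "A \<subseteq> carrier G" "finite A"
  then have "finite {k. h (n + k) \<in> A}"
    using assms by (simp add: tends_to_infinity_def)
  then have "finite ({..<n} \<union> (+) n ` {k. h (n + k) \<in> A})"
    by simp
  moreover have "{k. h k \<in> A} \<subseteq> {..<n} \<union> (+) n ` {k. h (n + k) \<in> A}"
  proof
    fix k assume "k \<in> {k. h k \<in> A}"
    then show "k \<in> {..<n} \<union> (+) n ` {k. h (n + k) \<in> A}"
      by (cases "k < n") (auto intro!: image_eqI[of _ _ "k - n"])
  qed
  ultimately show "finite {k. h k \<in> A}"
    by (rule rev_finite_subset)
qed

section \<open>Translates under the action\<close>

context measure_preserving_action
begin

lemma action_bij: "g \<in> carrier G \<Longrightarrow> bij (\<phi> g)"
  using inj_prop surj_prop by (simp add: bij_def)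

lemma action_image_mult:
  "g \<in> carrier G \<Longrightarrow> h \<in> carrier G \<Longrightarrow> \<phi> (g \<otimes> h) ` A = \<phi> g ` \<phi> h ` A"
  by (simp add: composition_rule image_comp o_def)

lemma group_G: "Group.group G"
  using group_hom group_hom.axioms(1) by blast

lemma action_inv_image: "g \<in> carrier G \<Longrightarrow> \<phi> (inv g) ` \<phi> g ` A = A"
  and action_image_inv: "g \<in> carrier G \<Longrightarrow> \<phi> g ` \<phi> (inv g) ` A = A"
  using homeo[of g] by (simp_all add: homeomorphism_def image_comp o_def)

lemma action_open: "g \<in> carrier G \<Longrightarrow> open U \<Longrightarrow> open (\<phi> g ` U)"
  using homeomorphism_imp_open_map[OF homeo, of g U] by simp

lemma action_continuous: "g \<in> carrier G \<Longrightarrow> continuous_on A (\<phi> g)"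
  using homeo[of g] by (auto simp: homeomorphism_def intro: continuous_on_subset)

lemma action_compact: "g \<in> carrier G \<Longrightarrow> compact K \<Longrightarrow> compact (\<phi> g ` K)"
  by (rule compact_continuous_image[OF action_continuous])

lemma action_borel:
  assumes g: "g \<in> carrier G" and A: "A \<in> sets borel"
  shows "\<phi> g ` A \<in> sets borel"
proof -
  interpret G: Group.group G by (rule group_G)
  have "\<phi> g ` A = \<phi> (inv g) -` A \<inter> space borel"
  proof (intro equalityI subsetI)
    fix x assume "x \<in> \<phi> (inv g) -` A \<inter> space borel"
    then show "x \<in> \<phi> g ` A"
      using homeo[OF g] by (intro image_eqI[of _ _ "\<phi> (inv g) x"]) (auto simp: homeomorphism_def)
  qed (use homeo[OF g] in \<open>auto simp: homeomorphism_def\<close>)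
  moreover have "\<phi> (inv g) \<in> borel_measurable borel"
    using action_continuous[of "inv g"] g by (intro borel_measurable_continuous_onI) auto
  ultimately show ?thesis
    using A by (simp only: measurable_sets)
qed

lemma emeasure_translate_Int:
  assumes "g \<in> carrier G" "A \<in> sets borel" "K \<in> sets borel"
  shows "emeasure \<mu> (\<phi> (inv g) ` A \<inter> K) = emeasure \<mu> (A \<inter> \<phi> g ` K)"
proof -
  interpret G: Group.group G by (rule group_G)
  have "\<phi> g ` (\<phi> (inv g) ` A \<inter> K) = A \<inter> \<phi> g ` K"
    by (simp add: image_Int[OF bij_is_inj[OF action_bij[OF assms(1)]]] action_image_inv[OF assms(1)])
  then show ?thesis
    using preserves_measure[OF assms(1), of "\<phi> (inv g) ` A \<inter> K"] action_borel assms by simp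
qed

lemma translates_meet_imp:
  assumes "g \<in> carrier G" "h \<in> carrier G" "\<phi> g ` A \<inter> \<phi> h ` A \<noteq> {}"
  shows "\<phi> (inv g \<otimes> h) ` A \<inter> A \<noteq> {}"
proof -
  interpret G: Group.group G by (rule group_G)
  have "\<phi> (inv g) ` (\<phi> g ` A \<inter> \<phi> h ` A) \<subseteq> \<phi> (inv g) ` \<phi> g ` A \<inter> \<phi> (inv g) ` \<phi> h ` A"
    by auto
  also have "\<dots> = A \<inter> \<phi> (inv g \<otimes> h) ` A"
    using assms(1,2) by (simp add: action_inv_image action_image_mult)
  finally show ?thesis
    using assms(3) by blast
qed

text \<open>
  The weights \<open>w\<close> are arbitrary, because the bound is applied both to the masses and to the
  perimeters in the translates of \<open>V\<close>. The sets \<open>H'\<close> in it are those whose translates do not overlap.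
\<close>

definition overlap_bound :: "nat \<Rightarrow> 'a set \<Rightarrow> bool" where
  "overlap_bound N V \<longleftrightarrow> (\<forall>H (w :: 'g \<Rightarrow> ennreal) c.
     finite H \<longrightarrow> H \<subseteq> carrier G \<longrightarrow>
     (\<forall>H'\<subseteq>H. disjoint_family_on (\<lambda>g. \<phi> g ` V) H' \<longrightarrow> sum w H' \<le> c) \<longrightarrow>
     sum w H \<le> of_nat N * c)"

lemma overlap_boundD:
  assumes "overlap_bound N V" "finite H" "H \<subseteq> carrier G"
    and "\<And>H'. H' \<subseteq> H \<Longrightarrow> disjoint_family_on (\<lambda>g. \<phi> g ` V) H' \<Longrightarrow> sum w H' \<le> c"
  shows "sum w H \<le> of_nat N * (c :: ennreal)"
  using assms unfolding overlap_bound_def by blast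

text \<open>
  The translates of \<open>V\<close> by \<open>x\<close> and \<open>y\<close> meet only if \<open>inv x \<otimes> y\<close> lies in the set of elements that move
  \<open>closure V\<close> to a set meeting it. That set is finite, and its cardinality bounds the degrees of the
  overlap graph.
\<close>

lemma ex_overlap_bound:
  assumes pd: "properly_discontinuous G \<phi>" and V: "precompact V"
  shows "\<exists>N. overlap_bound N V"
proof -
  interpret G: Group.group G by (rule group_G)
  define Z where "Z = {h \<in> carrier G. \<phi> h ` closure V \<inter> closure V \<noteq> {}}"
  have Z: "finite Z"
    using pd V by (simp add: Z_def properly_discontinuous_def precompact_def)
  define R where "R g h \<longleftrightarrow> \<phi> g ` V \<inter> \<phi> h ` V \<noteq> {}" for g h
  have "sum w H \<le> of_nat (Suc (card Z)) * c"
    if H: "finite H" "H \<subseteq> carrier G"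
      and c: "\<forall>H'\<subseteq>H. disjoint_family_on (\<lambda>g. \<phi> g ` V) H' \<longrightarrow> sum w H' \<le> c"
    for H c and w :: "'g \<Rightarrow> ennreal"
  proof (rule sum_le_of_independent_sums_le[OF H(1)])
    show "symp R"
      by (auto simp: symp_def R_def)
    show "sum w H' \<le> c" if "H' \<subseteq> H" "pairwise (\<lambda>x y. \<not> R x y) H'" for H'
      using c that by (auto simp: pairwise_def R_def disjoint_family_on_def)
    show "card {y \<in> H. y \<noteq> x \<and> R x y} \<le> card Z" if "x \<in> H" for x
    proof (rule card_inj_on_le[OF _ _ Z])
      have x: "x \<in> carrier G"
        using that H by auto
      show "inj_on (\<lambda>y. inv x \<otimes> y) {y \<in> H. y \<noteq> x \<and> R x y}"
        using x H by (intro inj_onI) (auto simp: subset_iff)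
      show "(\<lambda>y. inv x \<otimes> y) ` {y \<in> H. y \<noteq> x \<and> R x y} \<subseteq> Z"
      proof clarify
        fix y assume y: "y \<in> H" "R x y"
        then have yc: "y \<in> carrier G"
          using H by auto
        have "\<phi> (inv x \<otimes> y) ` V \<inter> V \<noteq> {}"
          using translates_meet_imp[OF x yc] y(2) by (simp add: R_def)
        moreover have "\<phi> (inv x \<otimes> y) ` V \<inter> V \<subseteq> \<phi> (inv x \<otimes> y) ` closure V \<inter> closure V"
          using closure_subset[of V] by auto
        ultimately show "inv x \<otimes> y \<in> Z"
          using x yc by (auto simp: Z_def)
      qed
    qed
  qed
  then show ?thesis
    unfolding overlap_bound_def by blast
qed

end

section \<open>Mass and perimeter in the translates of a cell\<close>

lemma (in relative_perimeter) sum_disjoint_le: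
  assumes H: "finite H" and E: "E \<in> sets borel"
    and U: "\<And>h. h \<in> H \<Longrightarrow> open (U h)" and disj: "disjoint_family_on U H"
  shows "(\<Sum>h\<in>H. P E (U h)) \<le> P E UNIV"
proof -
  obtain b where b: "bij_betw b {..<card H} H"
    using ex_bij_betw_nat_finite[OF H] by (auto simp: atLeast0LessThan)
  have bH: "b k \<in> H" if "k < card H" for k
    using b that by (auto simp: bij_betw_def)
  have inj: "k = l" if "k < card H" "l < card H" "b k = b l" for k l
    using b that by (auto simp: bij_betw_def inj_on_def)
  have "(\<Sum>h\<in>H. P E (U h)) = (\<Sum>k<card H. P E (U (b k)))"
    by (rule sum.reindex_bij_betw[OF b, symmetric])
  also have "\<dots> \<le> P E (\<Union>k<card H. U (b k))"
  proof (rule superadditivity[OF E])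
    show "open (U (b k))" if "k < card H" for k
      using U bH that by blast
    show "disjoint_family_on (\<lambda>k. U (b k)) {..<card H}"
      using disj bH inj unfolding disjoint_family_on_def by (metis lessThan_iff)
  qed
  also have "\<dots> \<le> P E UNIV"
    using U bH by (intro monotonicity E open_UN) auto
  finally show ?thesis .
qed

context measure_preserving_action
begin

lemma sum_emeasure_translates_le:
  assumes sets: "sets \<mu> = sets borel" and N: "overlap_bound N V" and V: "open V"
    and H: "finite H" "H \<subseteq> carrier G" and E: "E \<in> sets borel"
  shows "(\<Sum>g\<in>H. emeasure \<mu> (E \<inter> \<phi> g ` V)) \<le> of_nat N * emeasure \<mu> E"
proof (rule overlap_boundD[OF N H])
  fix H' assume H': "H' \<subseteq> H" "disjoint_family_on (\<lambda>g. \<phi> g ` V) H'"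
  have meas: "E \<inter> \<phi> g ` V \<in> sets \<mu>" if "g \<in> H'" for g
    using E H H' V that by (auto simp: sets intro!: sets.Int action_borel)
  have "(\<Sum>g\<in>H'. emeasure \<mu> (E \<inter> \<phi> g ` V)) = emeasure \<mu> (\<Union>g\<in>H'. E \<inter> \<phi> g ` V)"
  proof (rule sum_emeasure)
    show "disjoint_family_on (\<lambda>g. E \<inter> \<phi> g ` V) H'"
      using H'(2) unfolding disjoint_family_on_def by blast
  qed (use meas H H' finite_subset in auto)
  also have "\<dots> \<le> emeasure \<mu> E"
    using E by (intro emeasure_mono) (auto simp: sets)
  finally show "(\<Sum>g\<in>H'. emeasure \<mu> (E \<inter> \<phi> g ` V)) \<le> emeasure \<mu> E" .
qed

lemma sum_perimeter_translates_le:
  assumes P: "relative_perimeter G \<phi> \<mu> P" and N: "overlap_bound N V" and V: "open V"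
    and H: "finite H" "H \<subseteq> carrier G" and E: "E \<in> sets borel"
  shows "(\<Sum>g\<in>H. P E (\<phi> g ` V)) \<le> of_nat N * P E UNIV"
proof (rule overlap_boundD[OF N H])
  interpret relative_perimeter G \<phi> \<mu> P by (rule P)
  fix H' assume H': "H' \<subseteq> H" "disjoint_family_on (\<lambda>g. \<phi> g ` V) H'"
  show "(\<Sum>g\<in>H'. P E (\<phi> g ` V)) \<le> P E UNIV"
    using H H' V finite_subset[OF H'(1) H(1)] by (intro sum_disjoint_le E action_open) auto
qed

text \<open>
  Chebyshev's inequality for the masses in the cells, whose sum is at most \<open>N\<close> times the mass of \<open>E\<close>.
\<close>

lemma ex_card_bound_large_cells:
  assumes sets: "sets \<mu> = sets borel" and N: "overlap_bound N V" and V: "open V"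
    and "0 < \<delta>" "0 \<le> c"
  shows "\<exists>M. \<forall>E\<in>sets borel. emeasure \<mu> E \<le> ennreal c \<longrightarrow>
    finite {g \<in> carrier G. ennreal \<delta> < emeasure \<mu> (E \<inter> \<phi> g ` V)} \<and>
    card {g \<in> carrier G. ennreal \<delta> < emeasure \<mu> (E \<inter> \<phi> g ` V)} \<le> M"
proof (intro exI ballI impI)
  fix E assume E: "E \<in> sets borel" "emeasure \<mu> E \<le> ennreal c"
  show "finite {g \<in> carrier G. ennreal \<delta> < emeasure \<mu> (E \<inter> \<phi> g ` V)} \<and>
    card {g \<in> carrier G. ennreal \<delta> < emeasure \<mu> (E \<inter> \<phi> g ` V)} \<le> nat \<lceil>real N * c / \<delta>\<rceil>"
  proof (rule finite_if_finite_subsets_card_bdd)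
    fix H assume H: "H \<subseteq> {g \<in> carrier G. ennreal \<delta> < emeasure \<mu> (E \<inter> \<phi> g ` V)}" "finite H"
    have "ennreal (real (card H) * \<delta>) = (\<Sum>g\<in>H. ennreal \<delta>)"
      using \<open>0 < \<delta>\<close> by (simp add: ennreal_mult ennreal_of_nat_eq_real_of_nat)
    also have "\<dots> \<le> (\<Sum>g\<in>H. emeasure \<mu> (E \<inter> \<phi> g ` V))"
      using H by (intro sum_mono) auto
    also have "\<dots> \<le> of_nat N * emeasure \<mu> E"
      using H by (intro sum_emeasure_translates_le sets N V E) auto
    also have "\<dots> \<le> of_nat N * ennreal c"
      using E(2) by (rule mult_left_mono) simp
    also have "\<dots> = ennreal (real N * c)"
      using \<open>0 \<le> c\<close> by (simp add: ennreal_mult ennreal_of_nat_eq_real_of_nat)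
    finally have "real (card H) * \<delta> \<le> real N * c"
      using \<open>0 \<le> c\<close> by (simp add: ennreal_le_iff)
    then have "real (card H) \<le> real N * c / \<delta>"
      using \<open>0 < \<delta>\<close> by (simp add: pos_le_divide_eq)
    then show "card H \<le> nat \<lceil>real N * c / \<delta>\<rceil>"
      by linarith
  qed
qed

text \<open>
  Moving the inequality \<open>linear\<close> from \<open>V\<close> to its translates compares the mass with the perimeter cell by
  cell; the factor \<open>N\<close> pays for the overlaps when the perimeters are added up.
\<close>

lemma emeasure_small_cells_le:
  assumes sets: "sets \<mu> = sets borel" and P: "relative_perimeter G \<phi> \<mu> P"
    and N: "overlap_bound N V" and V: "open V" and E: "E \<in> sets borel"
    and linear: "\<And>F. F \<in> sets borel \<Longrightarrow> emeasure \<mu> (F \<inter> V) \<le> ennreal \<delta>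
      \<Longrightarrow> C * emeasure \<mu> (F \<inter> V) \<le> P F V"
    and H: "finite H" "H \<subseteq> carrier G"
    and small: "\<And>g. g \<in> H \<Longrightarrow> emeasure \<mu> (E \<inter> \<phi> g ` V) \<le> ennreal \<delta>"
  shows "C * emeasure \<mu> (\<Union>g\<in>H. E \<inter> \<phi> g ` V) \<le> of_nat N * P E UNIV"
proof -
  interpret relative_perimeter G \<phi> \<mu> P by (rule P)
  interpret G: Group.group G by (rule group_G)
  have le: "C * emeasure \<mu> (E \<inter> \<phi> g ` V) \<le> P E (\<phi> g ` V)" if g: "g \<in> H" for g
  proof -
    have gc: "g \<in> carrier G"
      using g H by auto
    let ?F = "\<phi> (inv g) ` E"
    have F: "?F \<in> sets borel"
      using gc E by (intro action_borel) auto
    have eq: "emeasure \<mu> (?F \<inter> V) = emeasure \<mu> (E \<inter> \<phi> g ` V)"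
      using gc E V by (intro emeasure_translate_Int) auto
    have "C * emeasure \<mu> (E \<inter> \<phi> g ` V) \<le> P ?F V"
      using linear[OF F] small[OF g] by (simp add: eq)
    also have "\<dots> = P (\<phi> g ` ?F) (\<phi> g ` V)"
      using invariance[OF gc F V] by simp
    finally show ?thesis
      by (simp add: action_image_inv[OF gc])
  qed
  have "emeasure \<mu> (\<Union>g\<in>H. E \<inter> \<phi> g ` V) \<le> (\<Sum>g\<in>H. emeasure \<mu> (E \<inter> \<phi> g ` V))"
    using E H V by (intro emeasure_subadditive_finite) (auto simp: sets intro!: sets.Int action_borel)
  then have "C * emeasure \<mu> (\<Union>g\<in>H. E \<inter> \<phi> g ` V) \<le> C * (\<Sum>g\<in>H. emeasure \<mu> (E \<inter> \<phi> g ` V))"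
    by (rule mult_left_mono) simp
  also have "\<dots> \<le> (\<Sum>g\<in>H. P E (\<phi> g ` V))"
    unfolding sum_distrib_left by (rule sum_mono) (rule le)
  also have "\<dots> \<le> of_nat N * P E UNIV"
    by (rule sum_perimeter_translates_le[OF P N V H E])
  finally show ?thesis .
qed

section \<open>Mass of the limits of diverging translates\<close>

lemma eventually_translates_disjoint:
  assumes pd: "properly_discontinuous G \<phi>" and K: "compact K" and F: "finite F"
    and g: "\<And>i k. i \<in> F \<Longrightarrow> g i k \<in> carrier G"
    and sep: "\<And>i i'. i \<in> F \<Longrightarrow> i' \<in> F \<Longrightarrow> i \<noteq> i' \<Longrightarrow>
      tends_to_infinity G (\<lambda>k. inv (g i' k) \<otimes> g i k)"
  shows "\<forall>\<^sub>F k in sequentially. disjoint_family_on (\<lambda>i. \<phi> (g i k) ` K) F"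
proof -
  define A where "A = {h \<in> carrier G. \<phi> h ` K \<inter> K \<noteq> {}}"
  have A: "A \<subseteq> carrier G" "finite A"
    using pd K by (auto simp: A_def properly_discontinuous_def)
  interpret G: Group.group G by (rule group_G)
  have pair: "\<forall>\<^sub>F k in sequentially. \<phi> (g i k) ` K \<inter> \<phi> (g i' k) ` K = {}"
    if "i \<in> F" "i' \<in> F" "i \<noteq> i'" for i i'
  proof -
    have "finite {k. inv (g i' k) \<otimes> g i k \<in> A}"
      using sep[OF that] A by (simp add: tends_to_infinity_def)
    then have "\<forall>\<^sub>F k in sequentially. inv (g i' k) \<otimes> g i k \<notin> A"
      by (simp add: eventually_cofinite flip: cofinite_eq_sequentially)
    then show ?thesis
    proof eventually_elim
      case (elim k)
      then show ?case
        using translates_meet_imp[of "g i' k" "g i k" K] g that by (auto simp: A_def Int_commute)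
    qed
  qed
  have "\<forall>\<^sub>F k in sequentially. \<forall>i\<in>F. \<forall>i'\<in>F. i \<noteq> i' \<longrightarrow> \<phi> (g i k) ` K \<inter> \<phi> (g i' k) ` K = {}"
  proof (intro eventually_ball_finite[OF F] ballI)
    fix i i' assume "i \<in> F" "i' \<in> F"
    then show "\<forall>\<^sub>F k in sequentially. i \<noteq> i' \<longrightarrow> \<phi> (g i k) ` K \<inter> \<phi> (g i' k) ` K = {}"
      by (cases "i = i'") (use pair in auto)
  qed
  then show ?thesis
    by (simp add: disjoint_family_on_def)
qed

text \<open>
  For a compact \<open>K\<close>, the masses of the limits in \<open>K\<close> are limits of the masses of \<open>E k\<close> in the sets
  \<open>\<phi> (g i k) ` K\<close>, which are disjoint for large \<open>k\<close>. Exhausting the space by closed balls, which are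
  compact by the Heine--Borel property, removes \<open>K\<close>.
\<close>

lemma sum_emeasure_limits_le:
  assumes sets: "sets \<mu> = sets borel" and hb: "heine_borel_property TYPE('a)"
    and pd: "properly_discontinuous G \<phi>"
    and E: "\<And>k. E k \<in> sets borel" and c: "\<And>k. emeasure \<mu> (E k) \<le> c" and F: "finite F"
    and g: "\<And>i k. i \<in> F \<Longrightarrow> g i k \<in> carrier G"
    and sep: "\<And>i i'. i \<in> F \<Longrightarrow> i' \<in> F \<Longrightarrow> i \<noteq> i' \<Longrightarrow>
      tends_to_infinity G (\<lambda>k. inv (g i' k) \<otimes> g i k)"
    and D: "\<And>i. i \<in> F \<Longrightarrow> D i \<in> sets borel"
    and conv: "\<And>i. i \<in> F \<Longrightarrow> L1loc_set_conv \<mu> (\<lambda>k. \<phi> (inv (g i k)) ` E k) (D i)"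
  shows "(\<Sum>i\<in>F. emeasure \<mu> (D i)) \<le> c"
proof -
  interpret G: Group.group G by (rule group_G)
  have on_compact: "(\<Sum>i\<in>F. emeasure \<mu> (D i \<inter> K)) \<le> c" if K: "compact K" for K
  proof -
    have Kb: "K \<in> sets borel"
      using K by (simp add: borel_closed compact_imp_closed)
    define d where "d i k = emeasure \<mu> (K \<inter> sym_diff (\<phi> (inv (g i k)) ` E k) (D i))" for i k
    have Fb: "\<phi> (inv (g i k)) ` E k \<in> sets borel" if "i \<in> F" for i k
      using g that E by (intro action_borel) auto
    have "(\<lambda>k. d i k) \<longlonglongrightarrow> 0" if "i \<in> F" for i
      unfolding d_def using that by (intro L1loc_set_conv_emeasure sets conv K Fb D)
    then have "(\<lambda>k. c + (\<Sum>i\<in>F. d i k)) \<longlonglongrightarrow> c + (\<Sum>i\<in>F. 0)"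
      by (intro tendsto_add tendsto_const tendsto_sum)
    then have lim: "(\<lambda>k. c + (\<Sum>i\<in>F. d i k)) \<longlonglongrightarrow> c"
      by simp
    have "\<forall>\<^sub>F k in sequentially. disjoint_family_on (\<lambda>i. \<phi> (g i k) ` K) F"
      by (rule eventually_translates_disjoint[OF pd K F]) (use g sep in auto)
    then have "\<forall>\<^sub>F k in sequentially. (\<Sum>i\<in>F. emeasure \<mu> (D i \<inter> K)) \<le> c + (\<Sum>i\<in>F. d i k)"
    proof eventually_elim
      case (elim k)
      have gK: "\<phi> (g i k) ` K \<in> sets borel" if "i \<in> F" for i
        using g[OF that] Kb by (rule action_borel)
      have "(\<Sum>i\<in>F. emeasure \<mu> (D i \<inter> K))
          \<le> (\<Sum>i\<in>F. emeasure \<mu> (\<phi> (inv (g i k)) ` E k \<inter> K) + d i k)"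
      proof (rule sum_mono)
        fix i assume i: "i \<in> F"
        have "sym_diff (D i) (\<phi> (inv (g i k)) ` E k) = sym_diff (\<phi> (inv (g i k)) ` E k) (D i)"
          by blast
        then show "emeasure \<mu> (D i \<inter> K) \<le> emeasure \<mu> (\<phi> (inv (g i k)) ` E k \<inter> K) + d i k"
          using emeasure_Int_le_add_sym_diff[of K \<mu> "D i" "\<phi> (inv (g i k)) ` E k"] Kb Fb[OF i] D[OF i]
          by (simp add: d_def sets)
      qed
      also have "\<dots> = (\<Sum>i\<in>F. emeasure \<mu> (E k \<inter> \<phi> (g i k) ` K)) + (\<Sum>i\<in>F. d i k)"
        using g E Kb by (simp add: sum.distrib emeasure_translate_Int)
      also have "(\<Sum>i\<in>F. emeasure \<mu> (E k \<inter> \<phi> (g i k) ` K))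
          = emeasure \<mu> (\<Union>i\<in>F. E k \<inter> \<phi> (g i k) ` K)"
        using elim E gK F by (intro sum_emeasure) (auto simp: sets disjoint_family_on_def)
      also have "\<dots> \<le> emeasure \<mu> (E k)"
        using E by (intro emeasure_mono) (auto simp: sets)
      also have "\<dots> \<le> c" by (rule c)
      finally show ?case
        by (simp add: add_right_mono)
    qed
    with lim show ?thesis
      by (intro tendsto_lowerbound[OF lim]) auto
  qed
  define x0 :: 'a where "x0 = undefined"
  have "(\<lambda>n. emeasure \<mu> (D i \<inter> cball x0 (real n))) \<longlonglongrightarrow> emeasure \<mu> (D i)" if "i \<in> F" for i
  proof -
    have "(\<Union>n. D i \<inter> cball x0 (real n)) = D i"
      using real_arch_simple by auto
    moreover have "(\<lambda>n. emeasure \<mu> (D i \<inter> cball x0 (real n)))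
        \<longlonglongrightarrow> emeasure \<mu> (\<Union>n. D i \<inter> cball x0 (real n))"
    proof (rule Lim_emeasure_incseq)
      show "range (\<lambda>n. D i \<inter> cball x0 (real n)) \<subseteq> sets \<mu>"
        using D[OF that] by (auto simp: sets)
      show "incseq (\<lambda>n. D i \<inter> cball x0 (real n))"
        unfolding incseq_def by (intro allI impI Int_mono subset_cball order_refl) simp
    qed
    ultimately show ?thesis by simp
  qed
  then have "(\<lambda>n. \<Sum>i\<in>F. emeasure \<mu> (D i \<inter> cball x0 (real n))) \<longlonglongrightarrow> (\<Sum>i\<in>F. emeasure \<mu> (D i))"
    by (rule tendsto_sum)
  moreover have "compact (cball x0 (real n))" for n
    using hb by (simp add: heine_borel_property_def)
  ultimately show ?thesis
    using on_compact by (intro LIMSEQ_le_const2) auto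
qed

text \<open>
  The translates may overlap here, as only subadditivity is used. The estimate passes to the limit
  because all the mass in question stays in one compact set \<open>K\<close>.
\<close>

lemma le_sum_emeasure_limits:
  assumes sets: "sets \<mu> = sets borel" and K: "compact K"
    and E: "\<And>k. E k \<in> sets borel" and F: "finite F"
    and g: "\<And>i k. i \<in> F \<Longrightarrow> g i k \<in> carrier G"
    and D: "\<And>i. i \<in> F \<Longrightarrow> D i \<in> sets borel"
    and conv: "\<And>i. i \<in> F \<Longrightarrow> L1loc_set_conv \<mu> (\<lambda>k. \<phi> (inv (g i k)) ` E k) (D i)"
    and mass: "\<forall>\<^sub>F k in sequentially. c \<le> emeasure \<mu> (E k \<inter> (\<Union>i\<in>F. \<phi> (g i k) ` K)) + \<eta>"
  shows "c \<le> (\<Sum>i\<in>F. emeasure \<mu> (D i)) + \<eta>"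
proof -
  interpret G: Group.group G by (rule group_G)
  have Kb: "K \<in> sets borel"
    using K by (simp add: borel_closed compact_imp_closed)
  define d where "d i k = emeasure \<mu> (K \<inter> sym_diff (\<phi> (inv (g i k)) ` E k) (D i))" for i k
  have Fb: "\<phi> (inv (g i k)) ` E k \<in> sets borel" if "i \<in> F" for i k
    using g that E by (intro action_borel) auto
  have "(\<lambda>k. d i k) \<longlonglongrightarrow> 0" if "i \<in> F" for i
    unfolding d_def using that by (intro L1loc_set_conv_emeasure sets conv K Fb D)
  then have "(\<lambda>k. (\<Sum>i\<in>F. emeasure \<mu> (D i)) + (\<Sum>i\<in>F. d i k) + \<eta>)
      \<longlonglongrightarrow> (\<Sum>i\<in>F. emeasure \<mu> (D i)) + (\<Sum>i\<in>F. 0) + \<eta>"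
    by (intro tendsto_add tendsto_const tendsto_sum)
  then have lim: "(\<lambda>k. (\<Sum>i\<in>F. emeasure \<mu> (D i)) + (\<Sum>i\<in>F. d i k) + \<eta>)
      \<longlonglongrightarrow> (\<Sum>i\<in>F. emeasure \<mu> (D i)) + \<eta>"
    by simp
  have "\<forall>\<^sub>F k in sequentially. c \<le> (\<Sum>i\<in>F. emeasure \<mu> (D i)) + (\<Sum>i\<in>F. d i k) + \<eta>"
    using mass
  proof eventually_elim
    case (elim k)
    have gK: "\<phi> (g i k) ` K \<in> sets borel" if "i \<in> F" for i
      using g[OF that] Kb by (rule action_borel)
    have "emeasure \<mu> (E k \<inter> (\<Union>i\<in>F. \<phi> (g i k) ` K)) = emeasure \<mu> (\<Union>i\<in>F. E k \<inter> \<phi> (g i k) ` K)"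
      by (simp only: Int_UN_distrib)
    also have "\<dots> \<le> (\<Sum>i\<in>F. emeasure \<mu> (E k \<inter> \<phi> (g i k) ` K))"
      using E gK F by (intro emeasure_subadditive_finite) (auto simp: sets)
    also have "\<dots> = (\<Sum>i\<in>F. emeasure \<mu> (\<phi> (inv (g i k)) ` E k \<inter> K))"
      using g E Kb by (simp add: emeasure_translate_Int)
    also have "\<dots> \<le> (\<Sum>i\<in>F. emeasure \<mu> (D i) + d i k)"
    proof (rule sum_mono)
      fix i assume i: "i \<in> F"
      have "emeasure \<mu> (\<phi> (inv (g i k)) ` E k \<inter> K) \<le> emeasure \<mu> (D i \<inter> K) + d i k"
        using emeasure_Int_le_add_sym_diff[of K \<mu> "\<phi> (inv (g i k)) ` E k" "D i"] Kb Fb[OF i] D[OF i]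
        by (simp add: d_def sets)
      also have "\<dots> \<le> emeasure \<mu> (D i) + d i k"
        using D[OF i] by (intro add_right_mono emeasure_mono) (auto simp: sets)
      finally show "emeasure \<mu> (\<phi> (inv (g i k)) ` E k \<inter> K) \<le> emeasure \<mu> (D i) + d i k" .
    qed
    finally have "emeasure \<mu> (E k \<inter> (\<Union>i\<in>F. \<phi> (g i k) ` K))
        \<le> (\<Sum>i\<in>F. emeasure \<mu> (D i)) + (\<Sum>i\<in>F. d i k)"
      by (simp only: sum.distrib)
    then show ?case
      by (rule order_trans[OF elim add_right_mono])
  qed
  then show ?thesis
    by (intro tendsto_lowerbound[OF lim]) auto
qed

end

context measure_preserving_action
begin

section \<open>Tightness, extraction and splitting\<close>

text \<open>
  The slope \<open>C\<close> is chosen so large that the cells with mass at most \<open>\<theta> n\<close> hold together at most \<open>\<eta>\<close>,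
  and \<open>n\<close> so large that \<open>f\<close> lies above the line of slope \<open>C\<close> on \<open>{0..\<theta> n}\<close>. Neither choice depends on
  \<open>k\<close>, hence the finite set \<open>J\<close> does not either. An index \<open>i\<close> encodes a threshold together with
  a position in the list of cells that exceed it.
\<close>

lemma ex_tight_translates:
  assumes sets: "sets \<mu> = sets borel" and pd: "properly_discontinuous G \<phi>"
    and P: "relative_perimeter G \<phi> \<mu> P"
    and E: "\<And>k. E k \<in> sets borel" and m: "0 \<le> m" "\<And>k. emeasure \<mu> (E k) = ennreal m"
    and bounded: "(SUP k. P (E k) UNIV) < \<infinity>"
    and V: "open V" "precompact V" and cover: "(\<Union>g\<in>carrier G. \<phi> g ` V) = UNIV"
    and "0 < \<epsilon>" and f0: "0 \<le> f 0" and f_deriv: "filterlim (\<lambda>t. f t / t) at_top (at_right 0)"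
    and isoperimetric: "\<And>F. F \<in> sets borel \<Longrightarrow> emeasure \<mu> (F \<inter> V) \<le> ennreal \<epsilon>
      \<Longrightarrow> ennreal (f (measure \<mu> (F \<inter> V))) \<le> P F V"
  shows "\<exists>g :: nat \<Rightarrow> nat \<Rightarrow> 'g. (\<forall>i k. g i k \<in> carrier G) \<and>
    (\<forall>\<eta>>0. \<exists>J. finite J \<and>
      (\<forall>k. ennreal m \<le> emeasure \<mu> (E k \<inter> (\<Union>i\<in>J. \<phi> (g i k) ` V)) + ennreal \<eta>))"
proof -
  interpret G: Group.group G by (rule group_G)
  obtain N where N: "overlap_bound N V"
    using ex_overlap_bound[OF pd V(2)] by blast
  obtain s where s: "0 \<le> s" "(SUP k. P (E k) UNIV) = ennreal s"
    using bounded by (cases "SUP k. P (E k) UNIV" rule: ennreal_cases) auto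
  have Ps: "P (E k) UNIV \<le> ennreal s" for k
    unfolding s(2)[symmetric] by (rule SUP_upper) simp
  define \<theta> where "\<theta> n = inverse (real (Suc n))" for n
  have \<theta>: "0 < \<theta> n" for n
    by (simp add: \<theta>_def)
  define T where "T n k = {g \<in> carrier G. ennreal (\<theta> n) < emeasure \<mu> (E k \<inter> \<phi> g ` V)}" for n k
  have "\<exists>M. \<forall>k. finite (T n k) \<and> card (T n k) \<le> M" for n
  proof -
    obtain M where "\<forall>E\<in>sets borel. emeasure \<mu> E \<le> ennreal m \<longrightarrow>
        finite {g \<in> carrier G. ennreal (\<theta> n) < emeasure \<mu> (E \<inter> \<phi> g ` V)} \<and>
        card {g \<in> carrier G. ennreal (\<theta> n) < emeasure \<mu> (E \<inter> \<phi> g ` V)} \<le> M"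
      using ex_card_bound_large_cells[OF sets N V(1) \<theta>[of n] m(1)] by blast
    then show ?thesis
      unfolding T_def using E m(2) by (intro exI[of _ M] allI) simp
  qed
  then obtain M where M: "\<And>n k. finite (T n k)" "\<And>n k. card (T n k) \<le> M n"
    by metis
  have "\<exists>e :: nat \<Rightarrow> 'g. range e \<subseteq> carrier G \<and> T n k \<subseteq> e ` {..<M n}" for n k
    using M G.one_closed by (intro ex_enumeration_of_card_le) (auto simp: T_def)
  then obtain e :: "nat \<Rightarrow> nat \<Rightarrow> nat \<Rightarrow> 'g"
    where e: "\<And>n k. range (e n k) \<subseteq> carrier G" "\<And>n k. T n k \<subseteq> e n k ` {..<M n}"
    by metis
  have ec: "e n k j \<in> carrier G" for n k j
    using e(1)[of n k] by (rule subsetD) simp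
  define g where "g i k = e (fst (prod_decode i)) k (snd (prod_decode i))" for i k
  have "\<exists>J. finite J \<and> (\<forall>k. ennreal m \<le> emeasure \<mu> (E k \<inter> (\<Union>i\<in>J. \<phi> (g i k) ` V)) + ennreal \<eta>)"
    if "0 < \<eta>" for \<eta>
  proof -
    \<comment> \<open>The summand \<open>1\<close> keeps \<open>C\<close> positive when the perimeters vanish.\<close>
    define C where "C = (real N * s + 1) / \<eta>"
    have "0 < real N * s + 1"
      using s(1) by (simp add: add_nonneg_pos)
    then have C: "0 < C" "C * \<eta> = real N * s + 1"
      using \<open>0 < \<eta>\<close> by (simp_all add: C_def)
    obtain \<delta> where \<delta>: "0 < \<delta>" "\<delta> \<le> \<epsilon>" "\<And>t. 0 \<le> t \<Longrightarrow> t \<le> \<delta> \<Longrightarrow> C * t \<le> f t"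
      using ex_linear_bound_of_superlinear[OF f_deriv f0 \<open>0 < \<epsilon>\<close>, of C] by blast
    obtain n where n: "\<theta> n < \<delta>"
      using reals_Archimedean[OF \<delta>(1)] unfolding \<theta>_def by blast
    have linear: "ennreal C * emeasure \<mu> (F \<inter> V) \<le> P F V"
      if F: "F \<in> sets borel" and le: "emeasure \<mu> (F \<inter> V) \<le> ennreal (\<theta> n)" for F
    proof -
      have eq: "emeasure \<mu> (F \<inter> V) = ennreal (measure \<mu> (F \<inter> V))"
        using le by (intro emeasure_eq_ennreal_measure) (auto simp: top_unique)
      have le': "measure \<mu> (F \<inter> V) \<le> \<theta> n"
        using le \<theta>[of n] by (simp add: eq ennreal_le_iff)
      have "ennreal C * emeasure \<mu> (F \<inter> V) = ennreal (C * measure \<mu> (F \<inter> V))"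
        using C(1) by (simp add: eq ennreal_mult)
      also have "\<dots> \<le> ennreal (f (measure \<mu> (F \<inter> V)))"
        using le' n by (intro ennreal_leI \<delta>(3)) auto
      also have "\<dots> \<le> P F V"
        using le' n \<delta>(2) \<open>0 < \<epsilon>\<close> by (intro isoperimetric F) (simp add: eq ennreal_le_iff)
      finally show ?thesis .
    qed
    define J where "J = (\<lambda>j. prod_encode (n, j)) ` {..<M n}"
    have "ennreal m \<le> emeasure \<mu> (E k \<inter> (\<Union>i\<in>J. \<phi> (g i k) ` V)) + ennreal \<eta>" for k
    proof -
      define A where "A = E k \<inter> (\<Union>i\<in>J. \<phi> (g i k) ` V)"
      define R where "R = (\<Union>h\<in>carrier G - T n k. E k \<inter> \<phi> h ` V)"
      have gi: "g i k \<in> carrier G" for i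
        by (simp add: g_def ec)
      have cell: "E k \<inter> \<phi> h ` V \<in> sets \<mu>" if "h \<in> carrier G" for h
        using E V(1) that by (auto simp: sets intro!: sets.Int action_borel)
      have R: "emeasure \<mu> R \<le> ennreal \<eta>"
        unfolding R_def
      proof (rule emeasure_UN_le_of_finite_subunions)
        show "countable (carrier G - T n k)"
          using countable_group by simp
        show "E k \<inter> \<phi> h ` V \<in> sets \<mu>" if "h \<in> carrier G - T n k" for h
          using cell that by simp
        fix H assume H: "finite H" "H \<subseteq> carrier G - T n k"
        have "ennreal C * emeasure \<mu> (\<Union>h\<in>H. E k \<inter> \<phi> h ` V) \<le> of_nat N * P (E k) UNIV"
          using H by (intro emeasure_small_cells_le[OF sets P N V(1) E linear]) (auto simp: T_def not_less)
        also have "\<dots> \<le> of_nat N * ennreal s"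
          by (intro mult_left_mono Ps) simp
        also have "\<dots> = ennreal (real N * s)"
          using s(1) by (simp add: ennreal_mult ennreal_of_nat_eq_real_of_nat)
        also have "\<dots> \<le> ennreal (C * \<eta>)"
          by (intro ennreal_leI) (simp add: C(2))
        also have "\<dots> = ennreal C * ennreal \<eta>"
          using C(1) \<open>0 < \<eta>\<close> by (simp add: ennreal_mult)
        finally show "emeasure \<mu> (\<Union>h\<in>H. E k \<inter> \<phi> h ` V) \<le> ennreal \<eta>"
          using C(1) by (simp add: ennreal_mult_le_mult_iff)
      qed
      have "A \<in> sets \<mu>"
      proof -
        have "open (\<Union>i\<in>J. \<phi> (g i k) ` V)"
          using V(1) gi by (intro open_UN ballI action_open)
        then show ?thesis
          unfolding A_def sets using E[of k] by (rule sets.Int[OF _ borel_open, rotated])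
      qed
      moreover have "R \<in> sets \<mu>"
        unfolding R_def
        by (rule sets.countable_UN'') (use countable_group cell in simp_all)
      moreover have "E k \<subseteq> A \<union> R"
      proof
        fix x assume x: "x \<in> E k"
        obtain h where h: "h \<in> carrier G" "x \<in> \<phi> h ` V"
          using cover by blast
        show "x \<in> A \<union> R"
        proof (cases "h \<in> T n k")
          case True
          then obtain j where "j < M n" "h = e n k j"
            using e(2) by blast
          then have "prod_encode (n, j) \<in> J" "g (prod_encode (n, j)) k = h"
            by (auto simp: J_def g_def)
          then show ?thesis
            using x h by (auto simp: A_def)
        next
          case False
          then show ?thesis
            using x h by (auto simp: R_def)
        qed
      qed
      ultimately have "ennreal m \<le> emeasure \<mu> A + emeasure \<mu> R"
        unfolding m(2)[of k, symmetric]
        by (intro order_trans[OF emeasure_mono emeasure_subadditive]) simp_all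
      also have "\<dots> \<le> emeasure \<mu> A + ennreal \<eta>"
        using R by (rule add_left_mono)
      finally show ?thesis
        by (simp add: A_def)
    qed
    then show ?thesis
      by (intro exI[of _ J]) (simp add: J_def)
  qed
  moreover have "g i k \<in> carrier G" for i k
    by (simp add: g_def ec)
  ultimately show ?thesis
    by blast
qed

text \<open>
  The perimeters of the translates are bounded by invariance, so they have limits on each ball by
  compactness. There are countably many conditions, each attainable on a subsequence and stable under
  passing to further subsequences, and one diagonal subsequence meets them all.
\<close>

lemma ex_convergent_subsequence:
  assumes sets: "sets \<mu> = sets borel" and hb: "heine_borel_property TYPE('a)"
    and P: "relative_perimeter G \<phi> \<mu> P"
    and E: "\<And>k. E k \<in> sets borel" and bounded: "(SUP k. P (E k) UNIV) < \<infinity>"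
    and g: "\<And>i k. g i k \<in> carrier G"
  shows "\<exists>r D. strict_mono (r :: nat \<Rightarrow> nat) \<and>
    (\<forall>i j :: nat. (\<exists>a. \<forall>\<^sub>F k in sequentially. inv (g i (r k)) \<otimes> g j (r k) = a) \<or>
      tends_to_infinity G (\<lambda>k. inv (g i (r k)) \<otimes> g j (r k))) \<and>
    (\<forall>i. D i \<in> sets borel \<and> L1loc_set_conv \<mu> (\<lambda>k. \<phi> (inv (g i (r k))) ` E (r k)) (D i))"
proof -
  interpret G: Group.group G by (rule group_G)
  interpret P: relative_perimeter G \<phi> \<mu> P by (rule P)
  define x0 :: 'a where "x0 = undefined"
  define F where "F i k = \<phi> (inv (g i k)) ` E k" for i k
  have F: "F i k \<in> sets borel" for i k
    unfolding F_def using g E by (intro action_borel) auto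
  define h where "h i j k = inv (g i k) \<otimes> g j k" for i j k
  have h: "h i j k \<in> carrier G" for i j k
    using g by (simp add: h_def)
  define settles where "settles i j s \<longleftrightarrow>
    (\<exists>a. \<forall>\<^sub>F k in sequentially. h i j (s k) = a) \<or> tends_to_infinity G (h i j \<circ> s)"
    for i j and s :: "nat \<Rightarrow> nat"
  define converges where "converges i n s \<longleftrightarrow>
    (\<exists>D\<in>sets borel. L1_set_conv_on \<mu> UNIV (\<lambda>k. F i (s k) \<inter> ball x0 (real n)) D)"
    for i n and s :: "nat \<Rightarrow> nat"
  have ex_settles: "\<exists>r. strict_mono r \<and> settles i j (s \<circ> r)" for i j and s :: "nat \<Rightarrow> nat"
    using ex_constant_or_tends_to_infinity_subseq[of "h i j \<circ> s" G] h
    by (simp add: settles_def o_def)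
  have ex_converges: "\<exists>r. strict_mono r \<and> converges i n (s \<circ> r)" for i n and s :: "nat \<Rightarrow> nat"
  proof -
    have "P (F i k) (ball x0 (real n)) \<le> (SUP k. P (E k) UNIV)" for k
    proof -
      have "P (F i k) (ball x0 (real n)) \<le> P (F i k) UNIV"
        using F by (intro P.monotonicity) auto
      also have "\<dots> = P (E k) UNIV"
        using P.invariance[of "inv (g i k)" "E k" UNIV] g E surj_prop by (simp add: F_def)
      also have "\<dots> \<le> (SUP k. P (E k) UNIV)"
        by (rule SUP_upper) simp
      finally show ?thesis .
    qed
    then have "(SUP k. P (F i (s k)) (ball x0 (real n))) \<le> (SUP k. P (E k) UNIV)"
      by (intro SUP_least)
    moreover have "precompact (ball x0 (real n))"
    proof -
      have "compact (cball x0 (real n))"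
        using hb by (simp add: heine_borel_property_def)
      moreover have "closure (ball x0 (real n)) \<subseteq> cball x0 (real n)"
        by (intro closure_minimal) auto
      ultimately show ?thesis
        unfolding precompact_def using compact_Int_closed[of "cball x0 (real n)" "closure (ball x0 (real n))"]
        by (simp add: Int_absorb1)
    qed
    ultimately have "\<exists>D\<in>sets borel. \<exists>r. strict_mono r \<and>
        L1_set_conv_on \<mu> UNIV (\<lambda>k. F i (s (r k)) \<inter> ball x0 (real n)) D"
      using bounded by (intro P.compactness F) (auto intro: le_less_trans)
    then show ?thesis
      unfolding converges_def o_def by blast
  qed
  \<comment> \<open>Left indices are pairs of translates, right indices a translate and the radius of a ball.\<close>
  define Q :: "(nat \<times> nat) + (nat \<times> nat) \<Rightarrow> (nat \<Rightarrow> nat) \<Rightarrow> bool"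
    where "Q x s = (case x of Inl (i, j) \<Rightarrow> settles i j s | Inr (i, n) \<Rightarrow> converges i n s)" for x s
  have "\<exists>r. strict_mono r \<and> (\<forall>x. Q x r)"
  proof (rule diagonal_subsequence)
    fix x and s :: "nat \<Rightarrow> nat"
    show "\<exists>r. strict_mono r \<and> Q x (s \<circ> r)"
    proof (cases x)
      case (Inl ij)
      then show ?thesis
        using ex_settles[of "fst ij" "snd ij" s] by (simp add: Q_def case_prod_beta)
    next
      case (Inr ij)
      then show ?thesis
        using ex_converges[of "fst ij" "snd ij" s] by (simp add: Q_def case_prod_beta)
    qed
  next
    fix x s and r :: "nat \<Rightarrow> nat"
    assume r: "strict_mono r" and Q: "Q x s"
    have "settles i j (s \<circ> r)" if "settles i j s" for i j
      using that[unfolded settles_def]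
    proof
      assume "\<exists>a. \<forall>\<^sub>F k in sequentially. h i j (s k) = a"
      then obtain a where "\<forall>\<^sub>F k in sequentially. h i j (s k) = a" ..
      then have "\<forall>\<^sub>F k in sequentially. h i j ((s \<circ> r) k) = a"
        unfolding o_def by (rule eventually_subseq[OF r])
      then show ?thesis
        unfolding settles_def by blast
    next
      assume "tends_to_infinity G (h i j \<circ> s)"
      then show ?thesis
        using tends_to_infinity_subseq[OF _ r, of G "h i j \<circ> s"] by (simp add: settles_def o_assoc)
    qed
    moreover have "converges i n (s \<circ> r)" if "converges i n s" for i n
      using that L1_set_conv_on_subseq[OF _ r] unfolding converges_def o_def by blast
    ultimately show "Q x (s \<circ> r)"
      using Q by (auto simp: Q_def split: sum.splits)
  next
    fix x s and n :: nat
    assume Q: "Q x (s \<circ> (+) n)"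
    have "settles i j s" if "settles i j (s \<circ> (+) n)" for i j
      using that[unfolded settles_def]
    proof
      assume "\<exists>a. \<forall>\<^sub>F k in sequentially. h i j ((s \<circ> (+) n) k) = a"
      then obtain a where "\<forall>\<^sub>F k in sequentially. h i j (s (k + n)) = a"
        by (auto simp: add.commute)
      then have "\<forall>\<^sub>F k in sequentially. h i j (s k) = a"
        by (simp only: eventually_sequentially_seg[of "\<lambda>k. h i j (s k) = a"])
      then show ?thesis
        by (auto simp: settles_def)
    next
      assume "tends_to_infinity G (h i j \<circ> (s \<circ> (+) n))"
      then show ?thesis
        using tends_to_infinity_tail[of G "h i j \<circ> s" n] by (simp add: settles_def o_assoc)
    qed
    moreover have "converges i l s" if "converges i l (s \<circ> (+) n)" for i l
      using that L1_set_conv_on_tail[of \<mu> UNIV "\<lambda>k. F i (s k) \<inter> ball x0 (real l)" n]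
      by (auto simp: converges_def)
    ultimately show "Q x s"
      using Q by (auto simp: Q_def split: sum.splits)
  qed
  then obtain r where r: "strict_mono r" "\<And>x. Q x r"
    by blast
  have settles: "settles i j r" for i j
    using r(2)[of "Inl (i, j)"] by (simp add: Q_def)
  have "\<exists>D\<in>sets borel. L1loc_set_conv \<mu> (\<lambda>k. F i (r k)) D" for i
  proof (rule L1loc_set_conv_of_balls[OF sets F])
    show "\<exists>D\<in>sets borel. L1_set_conv_on \<mu> UNIV (\<lambda>k. F i (r k) \<inter> ball x0 (real n)) D" for n
      using r(2)[of "Inr (i, n)"] by (simp add: Q_def converges_def)
  qed
  then obtain D where "\<And>i. D i \<in> sets borel \<and> L1loc_set_conv \<mu> (\<lambda>k. F i (r k)) (D i)"
    by metis
  then show ?thesis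
    using r(1) settles by (intro exI[of _ r] exI[of _ D]) (simp add: settles_def h_def F_def o_def)
qed

text \<open>
  The index set consists of the least index of each class of the relation \<open>sim\<close>, so that distinct kept
  indices diverge from each other. An index \<open>i\<close> that is dropped differs from its representative \<open>\<rho> i\<close>
  by an eventually constant factor \<open>a i\<close>, whose action only enlarges the compact set in which mass is
  measured.
\<close>

lemma ex_mass_splitting:
  assumes sets: "sets \<mu> = sets borel" and hb: "heine_borel_property TYPE('a)"
    and pd: "properly_discontinuous G \<phi>"
    and E: "\<And>k. E k \<in> sets borel" and m: "\<And>k. emeasure \<mu> (E k) = ennreal m"
    and g: "\<And>i k. g i k \<in> carrier G"
    and dichotomy: "\<And>i j :: nat. (\<exists>a. \<forall>\<^sub>F k in sequentially. inv (g i k) \<otimes> g j k = a) \<or>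
      tends_to_infinity G (\<lambda>k. inv (g i k) \<otimes> g j k)"
    and D: "\<And>i. D i \<in> sets borel"
    and conv: "\<And>i. L1loc_set_conv \<mu> (\<lambda>k. \<phi> (inv (g i k)) ` E k) (D i)"
    and V: "precompact V"
    and tight: "\<And>\<eta>. 0 < \<eta> \<Longrightarrow> \<exists>J. finite J \<and>
      (\<forall>k. ennreal m \<le> emeasure \<mu> (E k \<inter> (\<Union>i\<in>J. \<phi> (g i k) ` V)) + ennreal \<eta>)"
  shows "\<exists>I. (\<forall>i\<in>I. \<forall>i'\<in>I. i \<noteq> i' \<longrightarrow> tends_to_infinity G (\<lambda>k. inv (g i' k) \<otimes> g i k)) \<and>
    ((\<lambda>i. emeasure \<mu> (D i)) has_sum ennreal m) I"
proof -
  interpret G: Group.group G by (rule group_G)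
  define sim where "sim i j \<longleftrightarrow> (\<exists>a\<in>carrier G. \<forall>\<^sub>F k in sequentially. g j k = g i k \<otimes> a)" for i j
  have sim_iff: "sim i j \<longleftrightarrow> (\<exists>a. \<forall>\<^sub>F k in sequentially. inv (g i k) \<otimes> g j k = a)" for i j
  proof
    assume "sim i j"
    then obtain a where a: "a \<in> carrier G" "\<forall>\<^sub>F k in sequentially. g j k = g i k \<otimes> a"
      by (auto simp: sim_def)
    from a(2) have "\<forall>\<^sub>F k in sequentially. inv (g i k) \<otimes> g j k = a"
      by eventually_elim (use g a(1) in \<open>simp flip: G.m_assoc\<close>)
    then show "\<exists>a. \<forall>\<^sub>F k in sequentially. inv (g i k) \<otimes> g j k = a" ..
  next
    assume "\<exists>a. \<forall>\<^sub>F k in sequentially. inv (g i k) \<otimes> g j k = a"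
    then obtain a where a: "\<forall>\<^sub>F k in sequentially. inv (g i k) \<otimes> g j k = a" ..
    then obtain k where "inv (g i k) \<otimes> g j k = a"
      by (auto simp: eventually_sequentially)
    then have ac: "a \<in> carrier G"
      using g by (metis G.inv_closed G.m_closed)
    from a have "\<forall>\<^sub>F k in sequentially. g j k = g i k \<otimes> a"
      by eventually_elim (metis G.inv_solve_left ac g)
    with ac show "sim i j"
      by (auto simp: sim_def)
  qed
  have refl: "sim i i" for i
    unfolding sim_def by (intro bexI[of _ \<one>]) (use g in auto)
  have sym: "sim j i" if ij: "sim i j" for i j
  proof -
    obtain a where a: "a \<in> carrier G" "\<forall>\<^sub>F k in sequentially. g j k = g i k \<otimes> a"
      using ij by (auto simp: sim_def)
    from a(2) have "\<forall>\<^sub>F k in sequentially. g i k = g j k \<otimes> inv a"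
      by eventually_elim (use g a(1) in \<open>simp add: G.m_assoc\<close>)
    then show ?thesis
      using a(1) by (auto simp: sim_def)
  qed
  have trans: "sim i l" if ij: "sim i j" and jl: "sim j l" for i j l
  proof -
    obtain a b where ab: "a \<in> carrier G" "b \<in> carrier G"
        "\<forall>\<^sub>F k in sequentially. g j k = g i k \<otimes> a" "\<forall>\<^sub>F k in sequentially. g l k = g j k \<otimes> b"
      using ij jl by (auto simp: sim_def)
    from ab(3,4) have "\<forall>\<^sub>F k in sequentially. g l k = g i k \<otimes> (a \<otimes> b)"
      by eventually_elim (use g ab(1,2) in \<open>simp add: G.m_assoc\<close>)
    then show ?thesis
      using ab(1,2) by (auto simp: sim_def)
  qed
  define I where "I = {i. \<forall>j<i. \<not> sim j i}"
  define \<rho> where "\<rho> i = (LEAST j. sim j i)" for i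
  have \<rho>: "sim (\<rho> i) i" for i
    unfolding \<rho>_def by (rule LeastI[of "\<lambda>j. sim j i", OF refl])
  have \<rho>I: "\<rho> i \<in> I" for i
    unfolding I_def
  proof (intro CollectI allI impI notI)
    fix j assume j: "j < \<rho> i" "sim j (\<rho> i)"
    have "sim j i"
      by (rule trans[OF j(2) \<rho>])
    then show False
      using not_less_Least[OF j(1)[unfolded \<rho>_def]] by blast
  qed
  have sep: "tends_to_infinity G (\<lambda>k. inv (g i' k) \<otimes> g i k)" if "i \<in> I" "i' \<in> I" "i \<noteq> i'" for i i'
  proof -
    have "\<not> sim i' i"
      using that sym unfolding I_def by (metis (mono_tags, lifting) linorder_neqE_nat mem_Collect_eq)
    then show ?thesis
      using dichotomy[of i' i] by (simp add: sim_iff)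
  qed
  have upper: "(\<Sum>i\<in>F. emeasure \<mu> (D i)) \<le> ennreal m" if "finite F" "F \<subseteq> I" for F
    using that m by (intro sum_emeasure_limits_le[OF sets hb pd E _ _ g sep D conv]) auto
  have lower: "\<exists>F. finite F \<and> F \<subseteq> I \<and> ennreal m \<le> (\<Sum>i\<in>F. emeasure \<mu> (D i)) + ennreal \<eta>"
    if pos: "0 < \<eta>" for \<eta>
  proof -
    obtain J where J: "finite J"
        "\<And>k. ennreal m \<le> emeasure \<mu> (E k \<inter> (\<Union>i\<in>J. \<phi> (g i k) ` V)) + ennreal \<eta>"
      using tight[OF pos] by blast
    obtain a where a: "\<And>i. a i \<in> carrier G"
        "\<And>i. \<forall>\<^sub>F k in sequentially. g i k = g (\<rho> i) k \<otimes> a i"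
      using \<rho> unfolding sim_def by metis
    \<comment> \<open>A compact set absorbing the finitely many constant factors.\<close>
    define K where "K = (\<Union>i\<in>J. \<phi> (a i) ` closure V)"
    have K: "compact K"
      unfolding K_def using J(1) a(1) V
      by (intro compact_UN action_compact) (auto simp: precompact_def)
    then have Kb: "K \<in> sets borel"
      by (simp add: borel_closed compact_imp_closed)
    have "\<forall>\<^sub>F k in sequentially. \<forall>i\<in>J. g i k = g (\<rho> i) k \<otimes> a i"
      using J(1) a(2) by (intro eventually_ball_finite) auto
    then have "\<forall>\<^sub>F k in sequentially.
        ennreal m \<le> emeasure \<mu> (E k \<inter> (\<Union>i\<in>\<rho> ` J. \<phi> (g i k) ` K)) + ennreal \<eta>"
    proof eventually_elim
      case (elim k)
      have sub: "\<phi> (g i k) ` V \<subseteq> \<phi> (g (\<rho> i) k) ` K" if i: "i \<in> J" for i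
      proof -
        have "\<phi> (g i k) ` V = \<phi> (g (\<rho> i) k) ` \<phi> (a i) ` V"
          using elim i g a(1) by (simp add: action_image_mult)
        also have "\<dots> \<subseteq> \<phi> (g (\<rho> i) k) ` K"
          using i closure_subset[of V] by (intro image_mono) (auto simp: K_def)
        finally show ?thesis .
      qed
      have "E k \<inter> (\<Union>i\<in>\<rho> ` J. \<phi> (g i k) ` K) \<in> sets \<mu>"
        unfolding sets using E J(1) g Kb
        by (intro sets.Int sets.finite_UN action_borel) auto
      then have "emeasure \<mu> (E k \<inter> (\<Union>i\<in>J. \<phi> (g i k) ` V))
          \<le> emeasure \<mu> (E k \<inter> (\<Union>i\<in>\<rho> ` J. \<phi> (g i k) ` K))"
        by (rule emeasure_mono[rotated]) (use sub in blast)
      then show ?case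
        by (rule order_trans[OF J(2)[of k] add_right_mono])
    qed
    then have "ennreal m \<le> (\<Sum>i\<in>\<rho> ` J. emeasure \<mu> (D i)) + ennreal \<eta>"
      using J(1) by (intro le_sum_emeasure_limits[OF sets K E _ g D conv]) auto
    then show ?thesis
      using J(1) \<rho>I by (intro exI[of _ "\<rho> ` J"]) auto
  qed
  have "(\<Sum>\<^sub>\<infinity>i\<in>I. emeasure \<mu> (D i)) = (SUP F\<in>{F. finite F \<and> F \<subseteq> I}. \<Sum>i\<in>F. emeasure \<mu> (D i))"
    by (rule nonneg_infsum_complete) simp
  also have "\<dots> = ennreal m"
  proof (rule antisym)
    show "(SUP F\<in>{F. finite F \<and> F \<subseteq> I}. \<Sum>i\<in>F. emeasure \<mu> (D i)) \<le> ennreal m"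
      using upper by (auto intro!: SUP_least)
    show "ennreal m \<le> (SUP F\<in>{F. finite F \<and> F \<subseteq> I}. \<Sum>i\<in>F. emeasure \<mu> (D i))"
    proof (rule ennreal_le_epsilon)
      fix \<eta> :: real assume "0 < \<eta>"
      then obtain F where F: "finite F" "F \<subseteq> I" "ennreal m \<le> (\<Sum>i\<in>F. emeasure \<mu> (D i)) + ennreal \<eta>"
        using lower by blast
      have "(\<Sum>i\<in>F. emeasure \<mu> (D i)) \<le> (SUP F\<in>{F. finite F \<and> F \<subseteq> I}. \<Sum>i\<in>F. emeasure \<mu> (D i))"
        using F by (intro SUP_upper) simp
      then show "ennreal m \<le> (SUP F\<in>{F. finite F \<and> F \<subseteq> I}. \<Sum>i\<in>F. emeasure \<mu> (D i)) + ennreal \<eta>"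
        by (rule order_trans[OF F(3) add_right_mono])
    qed
  qed
  finally have "((\<lambda>i. emeasure \<mu> (D i)) has_sum ennreal m) I"
    using has_sum_infsum[OF nonneg_summable_on_complete[of I "\<lambda>i. emeasure \<mu> (D i)"]] by simp
  then show ?thesis
    using sep by blast
qed

end

section \<open>The decomposition into limit sets\<close>

theorem theorem3p3:
  fixes \<mu> :: "'a::metric_space measure"
    and G :: "('g, 'm) monoid_scheme"
    and \<phi> :: "'g \<Rightarrow> 'a \<Rightarrow> 'a"
    and P :: "'a set \<Rightarrow> 'a set \<Rightarrow> ennreal"
    and m \<epsilon> :: real
    and E :: "nat \<Rightarrow> 'a set"
    and B V :: "'a set"
    and f :: "real \<Rightarrow> real"
  assumes radon: "radon_measure \<mu>"
    and sigma_finite: "sigma_finite_measure \<mu>"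
    and nonzero: "emeasure \<mu> UNIV \<noteq> 0"
    and action: "measure_preserving_action G \<phi> \<mu>"
    and perimeter: "relative_perimeter G \<phi> \<mu> P"
    and heine_borel: "heine_borel_property TYPE('a)"
    and m_nonneg: "0 \<le> m"
    and E_borel: "\<And>k. E k \<in> sets borel"
    and E_measure: "\<And>k. emeasure \<mu> (E k) = ennreal m"
    and E_perimeter: "(SUP k. P (E k) UNIV) < \<infinity>"
    and prop_disc: "properly_discontinuous G \<phi>"
    and B_borel: "B \<in> sets borel"
    and B_precompact: "precompact B"
    and B_frontier: "emeasure \<mu> (frontier B) = 0"
    and B_covers: "(\<Union>g\<in>carrier G. \<phi> g ` B) = UNIV"
    and B_overlap: "\<And>g. g \<in> carrier G \<Longrightarrow> g \<noteq> \<one>\<^bsub>G\<^esub> \<Longrightarrow> emeasure \<mu> (\<phi> g ` B \<inter> B) = 0"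
    and eps_pos: "0 < \<epsilon>"
    and V_open: "open V"
    and V_precompact: "precompact V"
    and B_subset_V: "B \<subseteq> V"
    and f_nonneg: "\<And>t. 0 \<le> t \<Longrightarrow> 0 \<le> f t"
    and f_mono: "mono_on {0..} f"
    and f_zero: "f 0 = 0"
    and f_deriv: "filterlim (\<lambda>t. f t / t) at_top (at_right 0)"
    and isoperimetric:
      "\<And>F. F \<in> sets borel \<Longrightarrow> emeasure \<mu> (F \<inter> V) \<le> ennreal \<epsilon>
         \<Longrightarrow> ennreal (f (measure \<mu> (F \<inter> V))) \<le> P F V"
  shows "\<exists>(r :: nat \<Rightarrow> nat) (I :: nat set) (E' :: nat \<Rightarrow> 'a set) (g :: nat \<Rightarrow> nat \<Rightarrow> 'g).
           strict_mono r \<and>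
           (\<forall>i\<in>I. E' i \<in> sets borel \<and> (\<forall>k. g i k \<in> carrier G)) \<and>
           (\<forall>i\<in>I. \<forall>i'\<in>I. i \<noteq> i' \<longrightarrow>
              tends_to_infinity G (\<lambda>k. inv\<^bsub>G\<^esub> (g i' k) \<otimes>\<^bsub>G\<^esub> g i k)) \<and>
           (\<forall>i\<in>I. L1loc_set_conv \<mu> (\<lambda>k. \<phi> (inv\<^bsub>G\<^esub> (g i k)) ` E (r k)) (E' i)) \<and>
           ((\<lambda>i. emeasure \<mu> (E' i)) has_sum ennreal m) I"
proof -
  interpret A: measure_preserving_action G \<phi> \<mu> by (rule action)
  have sets: "sets \<mu> = sets borel"
    using radon by (simp add: radon_measure_def)
  have cover: "(\<Union>h\<in>carrier G. \<phi> h ` V) = UNIV"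
  proof -
    have "(\<Union>h\<in>carrier G. \<phi> h ` B) \<subseteq> (\<Union>h\<in>carrier G. \<phi> h ` V)"
      by (rule UN_mono[OF order_refl image_mono[OF B_subset_V]])
    then show ?thesis
      by (simp add: B_covers top.extremum_unique)
  qed
  have "\<exists>g :: nat \<Rightarrow> nat \<Rightarrow> 'g. (\<forall>i k. g i k \<in> carrier G) \<and>
    (\<forall>\<eta>>0. \<exists>J. finite J \<and>
      (\<forall>k. ennreal m \<le> emeasure \<mu> (E k \<inter> (\<Union>i\<in>J. \<phi> (g i k) ` V)) + ennreal \<eta>))"
    by (rule A.ex_tight_translates[OF sets prop_disc perimeter E_borel m_nonneg E_measure E_perimeter
          V_open V_precompact cover eps_pos f_nonneg[OF order_refl] f_deriv])
      (rule isoperimetric)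
  then obtain g :: "nat \<Rightarrow> nat \<Rightarrow> 'g" where g: "\<forall>i k. g i k \<in> carrier G"
    and tight: "\<forall>\<eta>>0. \<exists>J. finite J \<and>
      (\<forall>k. ennreal m \<le> emeasure \<mu> (E k \<inter> (\<Union>i\<in>J. \<phi> (g i k) ` V)) + ennreal \<eta>)"
    by (elim exE conjE) (rule that)
  have "\<exists>r D. strict_mono (r :: nat \<Rightarrow> nat) \<and>
    (\<forall>i j :: nat. (\<exists>a. \<forall>\<^sub>F k in sequentially. inv\<^bsub>G\<^esub> (g i (r k)) \<otimes>\<^bsub>G\<^esub> g j (r k) = a) \<or>
      tends_to_infinity G (\<lambda>k. inv\<^bsub>G\<^esub> (g i (r k)) \<otimes>\<^bsub>G\<^esub> g j (r k))) \<and>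
    (\<forall>i. D i \<in> sets borel \<and> L1loc_set_conv \<mu> (\<lambda>k. \<phi> (inv\<^bsub>G\<^esub> (g i (r k))) ` E (r k)) (D i))"
    using g by (intro A.ex_convergent_subsequence[OF sets heine_borel perimeter E_borel E_perimeter]) simp
  then obtain r :: "nat \<Rightarrow> nat" and D where r: "strict_mono r"
    and dichotomy: "\<forall>i j. (\<exists>a. \<forall>\<^sub>F k in sequentially. inv\<^bsub>G\<^esub> (g i (r k)) \<otimes>\<^bsub>G\<^esub> g j (r k) = a) \<or>
      tends_to_infinity G (\<lambda>k. inv\<^bsub>G\<^esub> (g i (r k)) \<otimes>\<^bsub>G\<^esub> g j (r k))"
    and D: "\<forall>i. D i \<in> sets borel \<and> L1loc_set_conv \<mu> (\<lambda>k. \<phi> (inv\<^bsub>G\<^esub> (g i (r k))) ` E (r k)) (D i)"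
    by (elim exE conjE) (rule that)
  have "\<exists>I. (\<forall>i\<in>I. \<forall>i'\<in>I. i \<noteq> i' \<longrightarrow>
        tends_to_infinity G (\<lambda>k. inv\<^bsub>G\<^esub> (g i' (r k)) \<otimes>\<^bsub>G\<^esub> g i (r k))) \<and>
      ((\<lambda>i. emeasure \<mu> (D i)) has_sum ennreal m) I"
  proof (rule A.ex_mass_splitting[OF sets heine_borel prop_disc E_borel E_measure])
    fix \<eta> :: real assume "0 < \<eta>"
    then obtain J where "finite J" and
      "\<forall>k. ennreal m \<le> emeasure \<mu> (E k \<inter> (\<Union>i\<in>J. \<phi> (g i k) ` V)) + ennreal \<eta>"
      using tight by blast
    then show "\<exists>J. finite J \<and>
        (\<forall>k. ennreal m \<le> emeasure \<mu> (E (r k) \<inter> (\<Union>i\<in>J. \<phi> (g i (r k)) ` V)) + ennreal \<eta>)"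
      by (intro exI[of _ J]) simp
  qed (use g dichotomy D V_precompact in simp_all)
  then obtain I where I: "\<forall>i\<in>I. \<forall>i'\<in>I. i \<noteq> i' \<longrightarrow>
        tends_to_infinity G (\<lambda>k. inv\<^bsub>G\<^esub> (g i' (r k)) \<otimes>\<^bsub>G\<^esub> g i (r k))"
      "((\<lambda>i. emeasure \<mu> (D i)) has_sum ennreal m) I"
    by (elim exE conjE) (rule that)
  have D_borel: "\<forall>i\<in>I. D i \<in> sets borel \<and> (\<forall>k. g i (r k) \<in> carrier G)"
    and D_limit: "\<forall>i\<in>I. L1loc_set_conv \<mu> (\<lambda>k. \<phi> (inv\<^bsub>G\<^esub> (g i (r k))) ` E (r k)) (D i)"
    using g D by simp_all
  show ?thesis
    by (rule exI[of _ r], rule exI[of _ I], rule exI[of _ D], rule exI[of _ "\<lambda>i k. g i (r k)"],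
        intro conjI) (fact r D_borel I D_limit)+
qed

end
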